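(* Let $T$ be a bounded linear operator on a complex Hilbert space $\mathcal{H}$ which is $k$-quasiparanormal for some positive integer $k$. (a) Suppose $T$ is invertible. Then (a$_1$) $T$ and $T^{-1}$ are paranormal (and hence $k$-quasiparanormal for every positive integer $k$); and (a$_2$) if one of $T^n$ or $T^{-n}$ is quasinormal for some positive integer $n$, then so is the other, and $T$ and $T^{-1}$ are normal. (b) More generally, if $T$ has dense range and $T^n$ is quasinormal for some positive integer $n$, then $T$ is normal.
   Context: $T$ is paranormal if $\|Tx\|^2\le\|T^2x\|\,\|x\|$ for every $x\in\mathcal{H}$. $T$ is $k$-quasiparanormal if $\|T(T^kx)\|^2\le\|T^2(T^kx)\|\,\|T^kx\|$ for every $x\in\mathcal{H}$. An operator $A$ is quasinormal if $(A^*A-AA^* )A=O$. *)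

theory Defs
  imports "HOL-Analysis.Analysis"
begin

class complex_inner = real_normed_vector +
  fixes scaleC :: "complex \<Rightarrow> 'a \<Rightarrow> 'a"
    and cinner :: "'a \<Rightarrow> 'a \<Rightarrow> complex"
  assumes scaleC_add_right: "scaleC a (x + y) = scaleC a x + scaleC a y"
    and scaleC_add_left: "scaleC (a + b) x = scaleC a x + scaleC b x"
    and scaleC_scaleC: "scaleC a (scaleC b x) = scaleC (a * b) x"
    and scaleC_one: "scaleC 1 x = x"
    and scaleR_scaleC: "scaleR r x = scaleC (complex_of_real r) x"
    and cinner_commute: "cinner x y = cnj (cinner y x)"
    and cinner_add_left: "cinner (x + y) z = cinner x z + cinner y z"
    and cinner_scaleC_left: "cinner (scaleC a x) y = a * cinner x y"
    and cinner_self_real: "Im (cinner x x) = 0"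
    and cinner_self_nonneg: "0 \<le> Re (cinner x x)"
    and cinner_self_eq_zero: "cinner x x = 0 \<longleftrightarrow> x = 0"
    and norm_eq_sqrt_cinner: "norm x = sqrt (Re (cinner x x))"

definition bounded_op :: "('a::complex_inner \<Rightarrow> 'a) \<Rightarrow> bool" where
  "bounded_op T \<longleftrightarrow> bounded_linear T \<and> (\<forall>c x. T (scaleC c x) = scaleC c (T x))"

definition adj :: "('a::complex_inner \<Rightarrow> 'a) \<Rightarrow> ('a \<Rightarrow> 'a)" where
  "adj T = (SOME S. \<forall>x y. cinner (T x) y = cinner x (S y))"

definition invertible_op :: "('a::complex_inner \<Rightarrow> 'a) \<Rightarrow> bool" where
  "invertible_op T \<longleftrightarrow> bounded_op T \<and>
     (\<exists>S. bounded_op S \<and> S \<circ> T = id \<and> T \<circ> S = id)"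

definition paranormal :: "('a::complex_inner \<Rightarrow> 'a) \<Rightarrow> bool" where
  "paranormal T \<longleftrightarrow> (\<forall>x. (norm (T x))\<^sup>2 \<le> norm ((T ^^ 2) x) * norm x)"

definition k_quasiparanormal :: "nat \<Rightarrow> ('a::complex_inner \<Rightarrow> 'a) \<Rightarrow> bool" where
  "k_quasiparanormal k T \<longleftrightarrow>
     (\<forall>x. (norm (T ((T ^^ k) x)))\<^sup>2 \<le> norm ((T ^^ 2) ((T ^^ k) x)) * norm ((T ^^ k) x))"

definition quasinormal :: "('a::complex_inner \<Rightarrow> 'a) \<Rightarrow> bool" where
  "quasinormal A \<longleftrightarrow> (\<forall>x. adj A (A (A x)) - A (adj A (A x)) = 0)"

definition normal_op :: "('a::complex_inner \<Rightarrow> 'a) \<Rightarrow> bool" where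
  "normal_op A \<longleftrightarrow> adj A \<circ> A = A \<circ> adj A"

end

theory Submission
  imports Defs "HOL-Complex_Analysis.Cauchy_Integral_Formula" "HOL-Real_Asymp.Real_Asymp"
begin

text \<open>Density of the range turns \<open>k\<close>-quasiparanormality into paranormality and quasinormality of
  \<open>T\<^sup>n\<close> into normality, with \<open>T\<^sup>n\<close> injective. Put \<open>b = T* T\<close> and \<open>h = T*\<^sup>n T\<^sup>n\<close>. By Fuglede's theorem
  \<open>h\<close> commutes with \<open>T\<close>. Paranormality means \<open>T*\<^sup>2 T\<^sup>2 - 2 r T* T + r\<^sup>2 \<ge> 0\<close> for all real \<open>r\<close>; conjugating by
  powers of \<open>T\<close> and summing gives \<open>(h - r\<^sup>n) (b - r) \<ge> 0\<close> for all \<open>r \<ge> 0\<close>. This forces \<open>b\<close> to be the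
  positive \<open>n\<close>-th root of \<open>h\<close>; Bernstein polynomials in \<open>h\<close>, in place of the spectral theorem, show that
  \<open>b\<close> commutes with everything that commutes with \<open>h\<close>, in particular with \<open>T\<close>. Then
  \<open>(T* T - T T*) T = 0\<close>, and \<open>T\<close> is normal because its range is dense.\<close>

section \<open>Inner products\<close>

text \<open>The inequality in \<open>r\<close> factors only because \<open>h\<close> commutes with
  \<open>T\<close>: then T*^(n+1) T^(n+1) = T* h T = h b, and the sum T*^(n+1) T^(n+1) - r h - r^n b
  + r^(n+1) splits as (x^n - r^n) (y - r) does for numbers. For numbers the reason for b = h^(1/n)
  is a change of sign: \<open>h - r^n\<close> changes sign at r = h^(1/n), so \<open>b - r\<close>
  has to change sign there as well. Nothing can be read off at that value of \<open>r\<close>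
  itself, where the product vanishes; this is why the operator version works with \<open>c\<close>
  times the root for \<open>c\<close> on both sides of 1. The factor \<open>h\<close> survives the
  limit, so what gets identified is \<open>h b\<close> and not \<open>b\<close>. Cancelling
  \<open>h\<close> is the purpose of the injectivity of T^n. All estimates are made on quadratic
  forms or matrix coefficients and all operators that occur are polynomial expressions, so neither
  spectral measures nor convergence in operator norm enter.\<close>

lemma cinner_add_right: "cinner x (y + z) = cinner x y + cinner x z"
  by (metis cinner_add_left cinner_commute complex_cnj_add)

lemma cinner_scaleC_right: "cinner x (scaleC a y) = cnj a * cinner x y"
  by (metis cinner_commute cinner_scaleC_left complex_cnj_mult)

lemma cinner_scaleR_left: "cinner (scaleR r x) y = of_real r * cinner x y"
  by (simp add: scaleR_scaleC cinner_scaleC_left)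

lemma cinner_scaleR_right: "cinner x (scaleR r y) = of_real r * cinner x y"
  by (simp add: scaleR_scaleC cinner_scaleC_right)

lemma cinner_zero_left [simp]: "cinner 0 y = 0"
  using cinner_scaleR_left[of 0 0 y] by simp

lemma cinner_zero_right [simp]: "cinner y 0 = 0"
  using cinner_scaleR_right[of y 0 0] by simp

lemma cinner_minus_left: "cinner (- x) y = - cinner x y"
  using cinner_scaleR_left[of "-1" x y] by simp

lemma cinner_minus_right: "cinner x (- y) = - cinner x y"
  using cinner_scaleR_right[of x "-1" y] by simp

lemma cinner_diff_left: "cinner (x - z) y = cinner x y - cinner z y"
  using cinner_add_left[of x "- z" y] by (simp add: cinner_minus_left)

lemma cinner_diff_right: "cinner x (y - z) = cinner x y - cinner x z"
  using cinner_add_right[of x y "- z"] by (simp add: cinner_minus_right)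

lemmas cinner_simps = cinner_add_left cinner_add_right cinner_diff_left cinner_diff_right
  cinner_minus_left cinner_minus_right cinner_scaleR_left cinner_scaleR_right
  cinner_scaleC_left cinner_scaleC_right

lemma Re_cinner_self: "Re (cinner x x) = (norm x)\<^sup>2"
  by (simp add: norm_eq_sqrt_cinner cinner_self_nonneg)

lemma cinner_self: "cinner x x = of_real ((norm x)\<^sup>2)"
  by (simp add: complex_eq_iff Re_cinner_self cinner_self_real)

lemma Re_cinner_commute: "Re (cinner x y) = Re (cinner y x)"
  by (metis cinner_commute complex_cnj(1) complex.sel(1) complex_surj)

lemma norm_scaleC: "norm (scaleC a x) = cmod a * norm x"
proof -
  have "of_real ((norm (scaleC a x))\<^sup>2) = a * cnj a * of_real ((norm x)\<^sup>2)"
    by (simp only: cinner_self[symmetric] cinner_scaleC_left cinner_scaleC_right mult.assoc mult.left_commute)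
  also have "\<dots> = of_real ((cmod a * norm x)\<^sup>2)"
    by (simp only: complex_norm_square[symmetric] power_mult_distrib of_real_mult of_real_power)
  finally have "(norm (scaleC a x))\<^sup>2 = (cmod a * norm x)\<^sup>2"
    by (simp only: of_real_eq_iff)
  then show ?thesis by simp
qed

lemma scaleC_zero [simp]: "scaleC a 0 = 0"
  using norm_scaleC[of a 0] by simp

lemma scaleC_diff_right: "scaleC a (x - y) = scaleC a x - scaleC a y"
  using scaleC_add_right[of a "x - y" y] by simp

text \<open>Shared by three arguments: Cauchy-Schwarz for the inner product, the first-order
  condition at the Riesz minimiser, and Cauchy-Schwarz for a positive form.\<close>

lemma discriminant_le:
  fixes a b c :: real
  assumes "\<And>t. 0 \<le> a + 2 * t * b + t\<^sup>2 * c" and "0 \<le> c"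
  shows "b\<^sup>2 \<le> a * c"
proof (cases "c = 0")
  case True
  have "b = 0"
  proof (rule ccontr)
    assume "b \<noteq> 0"
    \<comment> \<open>At this \<open>t\<close> the affine function takes the value -1.\<close>
    then show False
      using assms(1)[of "- (a + 1) / (2 * b)"] True by (simp add: field_simps)
  qed
  then show ?thesis using True by simp
next
  case False
  then have c: "c > 0" using assms(2) by simp
  have "0 \<le> a + 2 * (- b / c) * b + (- b / c)\<^sup>2 * c" by (rule assms)
  also have "\<dots> = a - b\<^sup>2 / c"
    using c by (simp add: field_simps power2_eq_square)
  finally show ?thesis using c by (simp add: field_simps)
qed

lemma norm_add_scaleR_sq:
  "(norm (x + t *\<^sub>R y))\<^sup>2 = (norm x)\<^sup>2 + 2 * t * Re (cinner x y) + t\<^sup>2 * (norm y)\<^sup>2"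
  unfolding Re_cinner_self[symmetric] using Re_cinner_commute[of y x]
  by (simp add: cinner_simps algebra_simps power2_eq_square)

lemma Re_cinner_le: "Re (cinner x y) \<le> norm x * norm y"
proof -
  have "(Re (cinner x y))\<^sup>2 \<le> (norm x)\<^sup>2 * (norm y)\<^sup>2"
  proof (rule discriminant_le)
    fix t :: real
    have "0 \<le> (norm (x + t *\<^sub>R y))\<^sup>2" by simp
    also have "\<dots> = (norm x)\<^sup>2 + 2 * t * Re (cinner x y) + t\<^sup>2 * (norm y)\<^sup>2"
      by (rule norm_add_scaleR_sq)
    finally show "0 \<le> (norm x)\<^sup>2 + 2 * t * Re (cinner x y) + t\<^sup>2 * (norm y)\<^sup>2" .
  qed simp
  then have "(Re (cinner x y))\<^sup>2 \<le> (norm x * norm y)\<^sup>2"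
    by (simp add: power_mult_distrib)
  then show ?thesis by (rule power2_le_imp_le) simp
qed

lemma norm_cinner_le: "cmod (cinner x y) \<le> norm x * norm y"
proof (cases "cinner x y = 0")
  case False
  \<comment> \<open>A unimodular factor that turns the inner product onto the positive real axis,
    where the bound for real parts already controls the modulus.\<close>
  define c where "c = cnj (cinner x y) / of_real (cmod (cinner x y))"
  have "cmod c = 1" using False by (simp add: c_def norm_divide)
  have "cinner (scaleC c x) y = of_real (cmod (cinner x y))"
    using False by (simp add: cinner_simps c_def field_simps complex_norm_square[symmetric]
        power2_eq_square flip: of_real_mult)
  then have "cmod (cinner x y) \<le> norm (scaleC c x) * norm y"
    using Re_cinner_le[of "scaleC c x" y] by simp
  then show ?thesis using \<open>cmod c = 1\<close> by (simp add: norm_scaleC)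
qed simp

lemma cinner_eqI:
  assumes "\<And>z. cinner z x = cinner z y"
  shows "x = y"
proof -
  have "cinner (x - y) (x - y) = 0" using assms by (simp add: cinner_simps)
  then show ?thesis by (simp add: cinner_self_eq_zero)
qed

lemma tendsto_cinner_left: "(f \<longlongrightarrow> x) F \<Longrightarrow> ((\<lambda>i. cinner (f i) y) \<longlongrightarrow> cinner x y) F"
proof -
  have "bounded_linear (\<lambda>x. cinner x y)"
    by (rule bounded_linear_intro[where K = "norm y"])
      (auto simp: cinner_simps norm_cinner_le scaleR_conv_of_real)
  then show "(f \<longlongrightarrow> x) F \<Longrightarrow> ((\<lambda>i. cinner (f i) y) \<longlongrightarrow> cinner x y) F"
    by (rule bounded_linear.tendsto)
qed

section \<open>Existence of adjoints\<close>

text \<open>The representing vector minimises \<open>\<parallel>x\<parallel>\<^sup>2 - 2 Re (\<phi> x)\<close>.\<close>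

lemma riesz_representation:
  fixes \<phi> :: "'a::{complex_inner, complete_space} \<Rightarrow> complex"
  assumes add: "\<And>x y. \<phi> (x + y) = \<phi> x + \<phi> y"
    and scale: "\<And>c x. \<phi> (scaleC c x) = c * \<phi> x"
    and bound: "\<And>x. cmod (\<phi> x) \<le> norm x * K"
  shows "\<exists>y. \<forall>x. \<phi> x = cinner x y"
proof -
  have scaleR: "\<phi> (r *\<^sub>R x) = of_real r * \<phi> x" for r x
    by (simp add: scaleR_scaleC scale)
  have bl: "bounded_linear \<phi>"
    by (rule bounded_linear_intro[where K = K]) (auto simp: add scaleR bound scaleR_conv_of_real)
  define J where "J x = (norm x)\<^sup>2 - 2 * Re (\<phi> x)" for x
  have low: "J x \<ge> - K\<^sup>2" for x
  proof -
    have "Re (\<phi> x) \<le> norm x * K" using bound[of x] complex_Re_le_cmod order_trans by blast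
    moreover have "0 \<le> (norm x - K)\<^sup>2" by simp
    ultimately show ?thesis by (simp add: J_def power2_eq_square algebra_simps)
  qed
  have bdd: "bdd_below (range J)" using low by (auto intro!: bdd_belowI)
  define I where "I = Inf (range J)"
  have IJ: "I \<le> J x" for x unfolding I_def by (rule cInf_lower) (auto simp: bdd)
  have "\<exists>x. J x < I + 1 / real (Suc n)" for n
  proof -
    have "\<exists>y\<in>range J. y < I + 1 / real (Suc n)"
      by (rule cInf_lessD) (auto simp: I_def)
    then show ?thesis by auto
  qed
  then obtain X where X: "J (X n) < I + 1 / real (Suc n)" for n by metis
  \<comment> \<open>Parallelogram law: the linear part of \<open>J\<close> cancels, so two points
    that nearly minimise \<open>J\<close> are close to each other.\<close>
  have par: "(norm (x - y))\<^sup>2 = 2 * (J x + J y - 2 * J ((1/2) *\<^sub>R (x + y)))" for x y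
    by (simp add: J_def Re_cinner_self[symmetric] cinner_simps add scaleR algebra_simps)
  have "Cauchy X"
  proof (rule metric_CauchyI)
    fix e :: real assume e: "e > 0"
    obtain M where M: "1 / real (Suc M) < e\<^sup>2 / 4"
      using e nat_approx_posE[of "e\<^sup>2 / 4"] by auto
    have "dist (X m) (X n) < e" if "m \<ge> M" "n \<ge> M" for m n
    proof -
      have *: "1 / real (Suc m) \<le> 1 / real (Suc M)" "1 / real (Suc n) \<le> 1 / real (Suc M)"
        using that by (auto intro!: divide_left_mono)
      have "J (X m) < I + e\<^sup>2 / 4" "J (X n) < I + e\<^sup>2 / 4"
        using X[of m] X[of n] M * by linarith+
      then have "(norm (X m - X n))\<^sup>2 < e\<^sup>2"
        using par[of "X m" "X n"] IJ[of "(1/2) *\<^sub>R (X m + X n)"] by argo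
      then show ?thesis using e by (simp add: dist_norm power_less_imp_less_base)
    qed
    then show "\<exists>M. \<forall>m\<ge>M. \<forall>n\<ge>M. dist (X m) (X n) < e" by blast
  qed
  then obtain y where y: "X \<longlonglongrightarrow> y" using Cauchy_convergent convergent_def by blast
  have "(\<lambda>n. J (X n)) \<longlonglongrightarrow> J y"
    unfolding J_def by (intro tendsto_intros y bounded_linear.tendsto[OF bl])
  moreover have "(\<lambda>n. I + 1 / real (Suc n)) \<longlonglongrightarrow> I"
    by real_asymp
  ultimately have Jy: "J y \<le> I"
    using X by (intro LIMSEQ_le) (auto intro!: exI[of _ 0] less_imp_le)
  have Re_eq: "Re (\<phi> v) = Re (cinner v y)" for v
  proof -
    \<comment> \<open>Moving from the minimiser \<open>y\<close> along \<open>v\<close> gives a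
      nonnegative quadratic in \<open>t\<close> with constant term 0, so its slope vanishes.\<close>
    have "(Re (cinner v y) - Re (\<phi> v))\<^sup>2 \<le> 0 * (norm v)\<^sup>2"
    proof (rule discriminant_le)
      fix t :: real
      have "J y \<le> J (y + t *\<^sub>R v)" using Jy IJ order_trans by blast
      also have "\<dots> = J y + 2 * t * (Re (cinner v y) - Re (\<phi> v)) + t\<^sup>2 * (norm v)\<^sup>2"
        unfolding J_def norm_add_scaleR_sq
        using Re_cinner_commute[of y v] by (simp add: add scaleR algebra_simps)
      finally show "0 \<le> 0 + 2 * t * (Re (cinner v y) - Re (\<phi> v)) + t\<^sup>2 * (norm v)\<^sup>2" by simp
    qed simp
    then show ?thesis by simp
  qed
  have "\<phi> v = cinner v y" for v
    using Re_eq[of v] Re_eq[of "scaleC \<i> v"] by (simp add: complex_eq_iff scale cinner_simps)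
  then show ?thesis by blast
qed

lemma bounded_op_linear: "bounded_op A \<Longrightarrow> bounded_linear A"
  by (simp add: bounded_op_def)

lemma bounded_op_scaleC: "bounded_op A \<Longrightarrow> A (scaleC c x) = scaleC c (A x)"
  by (simp add: bounded_op_def)

lemma bounded_opI:
  assumes "\<And>x y. A (x + y) = A x + A y" "\<And>c x. A (scaleC c x) = scaleC c (A x)"
    "\<And>x. norm (A x) \<le> norm x * K"
  shows "bounded_op A"
  unfolding bounded_op_def using assms
  by (auto intro!: bounded_linear_intro[where K = K] simp: scaleR_scaleC)

text \<open>\<open>adj\<close> is a choice, so nothing is known about it until some adjoint exists;
  Riesz provides its value at each \<open>y\<close>. Completeness of the space is used here, by way
  of Riesz.\<close>

lemma cinner_adj:
  fixes A :: "'a::{complex_inner, complete_space} \<Rightarrow> 'a"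
  assumes "bounded_op A"
  shows "cinner (A x) y = cinner x (adj A y)"
proof -
  interpret bounded_linear A using assms by (rule bounded_op_linear)
  obtain K where K: "norm (A x) \<le> norm x * K" for x using bounded by blast
  have "\<exists>w. \<forall>x. cinner (A x) y = cinner x w" for y
  proof (rule riesz_representation[where K = "K * norm y"])
    show "cmod (cinner (A x) y) \<le> norm x * (K * norm y)" for x
      using norm_cinner_le[of "A x" y] mult_right_mono[OF K[of x] norm_ge_zero[of y]]
      by (simp add: mult.assoc)
  qed (simp_all add: add bounded_op_scaleC[OF assms] cinner_simps)
  then have "\<exists>S. \<forall>x y. cinner (A x) y = cinner x (S y)" by metis
  then have "\<forall>x y. cinner (A x) y = cinner x (adj A y)"
    unfolding adj_def by (rule someI_ex)
  then show ?thesis by blast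
qed

lemma bounded_op_adj:
  fixes A :: "'a::{complex_inner, complete_space} \<Rightarrow> 'a"
  assumes "bounded_op A"
  shows "bounded_op (adj A)"
proof -
  interpret bounded_linear A using assms by (rule bounded_op_linear)
  obtain K where K: "norm (A x) \<le> norm x * K" for x using bounded by blast
  note cadj = cinner_adj[OF assms, symmetric]
  show ?thesis
  proof (rule bounded_opI[where K = K])
    show "adj A (x + y) = adj A x + adj A y" for x y
      by (rule cinner_eqI) (simp add: cadj cinner_simps)
    show "adj A (scaleC c x) = scaleC c (adj A x)" for c x
      by (rule cinner_eqI) (simp add: cadj cinner_simps)
    show "norm (adj A x) \<le> norm x * K" for x
    \<comment> \<open>The estimate ends by cancelling \<open>norm (adj A x)\<close>. When it is 0,
      nonnegativity of \<open>norm x * K\<close> has to come from the bound on \<open>A\<close>,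
      since \<open>K\<close> has no prescribed sign.\<close>
    proof (cases "adj A x = 0")
      case True
      have "norm (A x) \<le> norm x * K" by (rule K)
      then have "0 \<le> norm x * K" by (meson norm_ge_zero order_trans)
      then show ?thesis using True by simp
    next
      case False
      have "(norm (adj A x))\<^sup>2 = Re (cinner (A (adj A x)) x)"
        by (simp add: Re_cinner_self[symmetric] cadj)
      also have "\<dots> \<le> norm (A (adj A x)) * norm x" by (rule Re_cinner_le)
      also have "\<dots> \<le> norm (adj A x) * K * norm x"
        by (rule mult_right_mono[OF K]) simp
      finally show ?thesis using False by (simp add: power2_eq_square mult_ac)
    qed
  qed
qed

section \<open>The ring of bounded operators\<close>

text \<open>With bounded operators as a type, operator identities become ring identities that
  \<open>algebra_simps\<close> can settle.\<close>

typedef (overloaded) 'a bop = "{A :: 'a::complex_inner \<Rightarrow> 'a. bounded_op A}"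
  morphisms app Bop
  by (rule exI[of _ "\<lambda>x. x"]) (auto intro!: bounded_opI[where K = 1])

setup_lifting type_definition_bop

lemma bounded_op_zero: "bounded_op (\<lambda>x. 0)"
  by (rule bounded_opI[where K = 0]) auto

lemma bounded_op_id: "bounded_op (\<lambda>x. x)"
  by (rule bounded_opI[where K = 1]) auto

lemma bounded_op_add: "bounded_op A \<Longrightarrow> bounded_op B \<Longrightarrow> bounded_op (\<lambda>x. A x + B x)"
  by (simp add: bounded_op_def bounded_linear_add scaleC_add_right)

lemma bounded_op_minus: "bounded_op A \<Longrightarrow> bounded_op (\<lambda>x. - A x)"
  using scaleC_diff_right[of _ 0 "A _"]
  by (simp add: bounded_op_def bounded_linear_minus)

lemma bounded_op_compose: "bounded_op A \<Longrightarrow> bounded_op B \<Longrightarrow> bounded_op (\<lambda>x. A (B x))"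
  by (simp add: bounded_op_def bounded_linear_compose)

lemma bounded_op_scaled:
  assumes "bounded_op A" shows "bounded_op (\<lambda>x. scaleC c (A x))"
proof -
  interpret bounded_linear A using assms by (rule bounded_op_linear)
  obtain K where K: "norm (A x) \<le> norm x * K" for x using bounded by blast
  show ?thesis
  proof (rule bounded_opI[where K = "cmod c * K"])
    show "norm (scaleC c (A x)) \<le> norm x * (cmod c * K)" for x
      using mult_left_mono[OF K[of x] norm_ge_zero[of c]] by (simp add: norm_scaleC mult_ac)
  qed (simp_all add: add scaleC_add_right scaleC_scaleC bounded_op_scaleC[OF assms] mult.commute)
qed

instantiation bop :: (complex_inner) ring
begin
lift_definition zero_bop :: "'a bop" is "\<lambda>x. 0" by (rule bounded_op_zero)
lift_definition plus_bop :: "'a bop \<Rightarrow> 'a bop \<Rightarrow> 'a bop" is "\<lambda>A B x. A x + B x"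
  by (rule bounded_op_add)
lift_definition uminus_bop :: "'a bop \<Rightarrow> 'a bop" is "\<lambda>A x. - A x" by (rule bounded_op_minus)
definition minus_bop :: "'a bop \<Rightarrow> 'a bop \<Rightarrow> 'a bop" where "minus_bop a b = a + - b"
lift_definition times_bop :: "'a bop \<Rightarrow> 'a bop \<Rightarrow> 'a bop" is "\<lambda>A B x. A (B x)"
  by (rule bounded_op_compose)
instance
proof
  fix a b c :: "'a bop"
  show "a * (b + c) = a * b + a * c"
    by transfer (auto simp: bounded_op_def linear_simps)
qed (transfer; auto simp: minus_bop_def add_ac)+
end

text \<open>Together with \<open>ring\<close> this stops short of \<open>ring_1\<close>: on the zero
  space the operators 0 and 1 coincide.\<close>

instantiation bop :: (complex_inner) monoid_mult
begin
lift_definition one_bop :: "'a bop" is "\<lambda>x. x" by (rule bounded_op_id)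
instance by standard (transfer; simp)+
end

instantiation bop :: (complex_inner) real_algebra
begin
definition scaleR_bop :: "real \<Rightarrow> 'a bop \<Rightarrow> 'a bop" where
  "scaleR_bop r a = Bop (\<lambda>x. r *\<^sub>R app a x)"
lemma app_scaleR [simp]: "app (r *\<^sub>R a) x = r *\<^sub>R app a x"
proof -
  have "bounded_op (\<lambda>x. scaleC (of_real r) (app a x))"
    by (rule bounded_op_scaled) (use app[of a] in simp)
  then show ?thesis by (simp add: scaleR_bop_def Bop_inverse scaleR_scaleC)
qed
instance
proof
  fix a b :: "'a bop" and r s :: real
  note [simp] = plus_bop.rep_eq times_bop.rep_eq
  have bl: "bounded_linear (app a)" using app[of a] bounded_op_linear by blast
  show "r *\<^sub>R (a + b) = r *\<^sub>R a + r *\<^sub>R b"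
    by (rule app_inject[THEN iffD1]) (auto simp: scaleR_right_distrib)
  show "(r + s) *\<^sub>R a = r *\<^sub>R a + s *\<^sub>R a"
    by (rule app_inject[THEN iffD1]) (auto simp: scaleR_left_distrib)
  show "r *\<^sub>R s *\<^sub>R a = (r * s) *\<^sub>R a"
    by (rule app_inject[THEN iffD1]) auto
  show "1 *\<^sub>R a = a"
    by (rule app_inject[THEN iffD1]) auto
  show "r *\<^sub>R a * b = r *\<^sub>R (a * b)"
    by (rule app_inject[THEN iffD1]) auto
  show "a * r *\<^sub>R b = r *\<^sub>R (a * b)"
    by (rule app_inject[THEN iffD1]) (use bl in \<open>auto simp: linear_simps\<close>)
qed
end

lemma app_bounded_op [simp]: "bounded_op (app a)"
  using app[of a] by simp

lemma app_bounded_linear [simp]: "bounded_linear (app a)"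
  by (simp add: bounded_op_linear)

lemma app_zero [simp]: "app 0 x = 0" and app_one [simp]: "app 1 x = x"
  and app_plus [simp]: "app (a + b) x = app a x + app b x"
  and app_uminus [simp]: "app (- a) x = - app a x"
  and app_times [simp]: "app (a * b) x = app a (app b x)"
  by (transfer; simp)+

lemma app_minus [simp]: "app (a - b) x = app a x - app b x"
  unfolding minus_bop_def app_plus app_uminus by simp

lemma bop_eqI: "(\<And>x. app a x = app b x) \<Longrightarrow> a = b"
  by (rule app_inject[THEN iffD1]) (rule ext)

lemma app_zero_right [simp]: "app a 0 = 0"
  and app_add_right: "app a (x + y) = app a x + app a y"
  and app_diff_right: "app a (x - y) = app a x - app a y"
  and app_scaleR_right: "app a (r *\<^sub>R x) = r *\<^sub>R app a x"
  by (simp_all add: linear_simps)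

lemma app_scaleC_right: "app a (scaleC c x) = scaleC c (app a x)"
  by (simp add: bounded_op_scaleC)

lemma app_power: "app (a ^ n) = app a ^^ n"
  by (induction n) auto

text \<open>Complex multiples serve the holomorphic argument in Fuglede's theorem; everything else
  uses the real \<open>scaleR\<close>.\<close>

lift_definition cscale :: "complex \<Rightarrow> 'a::complex_inner bop \<Rightarrow> 'a bop"
  is "\<lambda>c A x. scaleC c (A x)" by (rule bounded_op_scaled)

lemma app_cscale [simp]: "app (cscale c a) x = scaleC c (app a x)"
  by transfer simp

lemma cscale_mult_left: "cscale c a * b = cscale c (a * b)"
  and cscale_mult_right: "a * cscale c b = cscale c (a * b)"
  by (rule bop_eqI; simp add: app_scaleC_right)+

lemma cscale_cscale: "cscale c (cscale d a) = cscale (c * d) a"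
  by (rule bop_eqI) (simp add: scaleC_scaleC)

lemma cscale_zero [simp]: "cscale 0 a = 0"
  by (rule bop_eqI) (use scaleR_scaleC[of 0] in simp)

section \<open>The adjoint as an involution\<close>

lift_definition star :: "'a::{complex_inner, complete_space} bop \<Rightarrow> 'a bop" is adj
  by (rule bounded_op_adj)

lemma app_star: "app (star a) = adj (app a)"
  by transfer simp

lemma cinner_star: "cinner (app a x) y = cinner x (app (star a) y)"
  by (simp add: app_star cinner_adj)

lemma cinner_star': "cinner x (app a y) = cinner (app (star a) x) y"
  by (metis cinner_commute cinner_star)

lemma star_eqI:
  assumes "\<And>x y. cinner (app a x) y = cinner x (app b y)"
  shows "star a = b"
  by (rule bop_eqI, rule cinner_eqI) (simp add: assms cinner_star[symmetric])

lemma star_star [simp]: "star (star a) = a"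
  by (rule star_eqI) (simp add: cinner_star')

lemma star_mult [simp]: "star (a * b) = star b * star a"
  by (rule star_eqI) (simp add: cinner_star)

lemma star_one [simp]: "star 1 = 1"
  by (rule star_eqI) simp

lemma star_zero [simp]: "star 0 = 0"
  by (rule star_eqI) simp

lemma star_add [simp]: "star (a + b) = star a + star b"
  by (rule star_eqI) (simp add: cinner_star cinner_simps)

lemma star_uminus [simp]: "star (- a) = - star a"
  by (rule star_eqI) (simp add: cinner_star cinner_simps)

lemma star_diff [simp]: "star (a - b) = star a - star b"
  by (rule star_eqI) (simp add: cinner_star cinner_simps)

lemma star_scaleR [simp]: "star (r *\<^sub>R a) = r *\<^sub>R star a"
  by (rule star_eqI) (simp add: cinner_star cinner_simps)

lemma star_cscale [simp]: "star (cscale c a) = cscale (cnj c) (star a)"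
  by (rule star_eqI) (simp add: cinner_star cinner_simps)

lemma star_power [simp]: "star (a ^ n) = star a ^ n"
  by (induction n) (auto simp: power_commutes)

lemma power_commuting:
  fixes a b :: "'a::monoid_mult"
  assumes "a * b = b * a"
  shows "a ^ n * b = b * a ^ n"
  by (induction n) (simp_all add: mult.assoc assms, metis assms mult.assoc)

section \<open>Fuglede's theorem\<close>

text \<open>An upper bound for the operator norm, kept as a predicate: the estimates only compose
  bounds and never ask for the least one.\<close>

definition op_bound :: "real \<Rightarrow> 'a::complex_inner bop \<Rightarrow> bool" where
  "op_bound K a \<longleftrightarrow> 0 \<le> K \<and> (\<forall>x. norm (app a x) \<le> K * norm x)"

lemma op_bound_exists: "\<exists>K. op_bound K a"
proof -
  obtain K where "0 < K" "\<And>x. norm (app a x) \<le> norm x * K"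
    using bounded_linear.pos_bounded[OF app_bounded_linear] by blast
  then show ?thesis by (intro exI[of _ K]) (simp add: op_bound_def mult.commute)
qed

lemma op_boundD: "op_bound K a \<Longrightarrow> norm (app a x) \<le> K * norm x"
  by (simp add: op_bound_def)

lemma op_bound_nonneg: "op_bound K a \<Longrightarrow> 0 \<le> K"
  by (simp add: op_bound_def)

lemma op_bound_one: "op_bound 1 1"
  by (simp add: op_bound_def)

lemma op_bound_mult:
  assumes "op_bound J a" "op_bound K b"
  shows "op_bound (J * K) (a * b)"
  unfolding op_bound_def
proof (intro conjI allI)
  show "0 \<le> J * K" using assms by (simp add: op_bound_nonneg)
  fix x
  have "norm (app a (app b x)) \<le> J * norm (app b x)" by (rule op_boundD[OF assms(1)])
  also have "\<dots> \<le> J * (K * norm x)"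
    by (rule mult_left_mono[OF op_boundD[OF assms(2)] op_bound_nonneg[OF assms(1)]])
  finally show "norm (app (a * b) x) \<le> J * K * norm x" by (simp add: mult.assoc)
qed

lemma op_bound_power: "op_bound K a \<Longrightarrow> op_bound (K ^ n) (a ^ n)"
  by (induction n) (auto simp: op_bound_one op_bound_mult)

lemma op_bound_add:
  assumes "op_bound J a" "op_bound K b"
  shows "op_bound (J + K) (a + b)"
  unfolding op_bound_def
proof (intro conjI allI)
  show "0 \<le> J + K" using assms by (simp add: op_bound_nonneg)
  show "norm (app (a + b) x) \<le> (J + K) * norm x" for x
    using op_boundD[OF assms(1), of x] op_boundD[OF assms(2), of x]
      norm_triangle_ineq[of "app a x" "app b x"] by (simp add: distrib_right)
qed

lemma op_bound_uminus: "op_bound K a \<Longrightarrow> op_bound K (- a)"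
  by (simp add: op_bound_def)

lemma op_bound_diff: "op_bound J a \<Longrightarrow> op_bound K b \<Longrightarrow> op_bound (J + K) (a - b)"
  using op_bound_add[of J a K "- b"] op_bound_uminus[of K b] by simp

lemma op_bound_cscale: "op_bound K a \<Longrightarrow> op_bound (cmod c * K) (cscale c a)"
  by (simp add: op_bound_def norm_scaleC mult.assoc mult_left_mono)

lemma power_commuting_diff_one: "v * (1 - v) ^ m = (1 - v) ^ m * (v::'a::complex_inner bop)"
  by (rule power_commuting[symmetric]) (simp add: algebra_simps)

text \<open>Every nonconstant term of the binomial expansion is replaced by its bound. In Fuglede's
  theorem \<open>e\<close> is of order 1/m^2, so the resulting bound tends to 0.\<close>

lemma op_bound_power_diff_one:
  assumes "op_bound e v"
  shows "op_bound ((1 + e) ^ m - 1) ((1 - v) ^ m - 1)"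
proof (induction m)
  case 0
  show ?case by (simp add: op_bound_def)
next
  case (Suc m)
  have "op_bound (((1 + e) ^ m - 1) * (1 + e) + e) (((1 - v) ^ m - 1) * (1 - v) - v)"
    by (intro op_bound_diff op_bound_mult Suc.IH op_bound_one assms)
  moreover have "((1 + e) ^ m - 1) * (1 + e) + e = (1 + e) ^ Suc m - 1"
    by (simp add: algebra_simps)
  moreover have "((1 - v) ^ m - 1) * (1 - v) - v = (1 - v) ^ Suc m - 1"
    by (simp add: algebra_simps power_commuting_diff_one)
  ultimately show ?case by simp
qed

lemma op_bound_cinner:
  assumes "op_bound K a" shows "cmod (cinner (app a x) y) \<le> K * norm x * norm y"
  using norm_cinner_le[of "app a x" y] mult_right_mono[OF op_boundD[OF assms, of x] norm_ge_zero[of y]]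
  by simp

text \<open>Matrix coefficients reduce the operator pencil to scalar polynomials in
  \<open>z\<close>, accessible to one-variable complex analysis. Peeling off one factor splits the
  coefficient into two shorter ones: on the left the extra \<open>a\<close> is absorbed into
  \<open>t\<close>, on the right into \<open>x\<close>, which is why the inductions generalise over
  these. For \<open>p = q\<close> the derivative at 0 is a multiple of the commutator of
  \<open>a\<close> and \<open>t\<close>.\<close>

lemma has_derivative_pencil:
  fixes a t :: "'a::complex_inner bop"
  shows "\<exists>f'. \<forall>z. ((\<lambda>z. cinner (app ((1 + cscale z a) ^ p * t * (1 - cscale z a) ^ q) x) y)
      has_field_derivative f' z) (at z)
    \<and> f' 0 = of_nat p * cinner (app (a * t) x) y - of_nat q * cinner (app (t * a) x) y"
    (is "\<exists>f'. ?D p q x f'")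
proof (induction q arbitrary: x)
  case 0
  show ?case
  proof (induction p arbitrary: y t)
    case 0
    show ?case by (rule exI[of _ "\<lambda>_. 0"]) auto
  next
    case (Suc p)
    obtain f where f: "\<And>z. ((\<lambda>z. cinner (app ((1 + cscale z a) ^ p * t) x) y)
        has_field_derivative f z) (at z)" "f 0 = of_nat p * cinner (app (a * t) x) y"
      using Suc.IH[of t y] by auto
    obtain g where g: "\<And>z. ((\<lambda>z. cinner (app ((1 + cscale z a) ^ p * (a * t)) x) y)
        has_field_derivative g z) (at z)"
      using Suc.IH[of "a * t" y] by auto
    let ?F = "\<lambda>z. cinner (app ((1 + cscale z a) ^ p * t) x) y"
    let ?G = "\<lambda>z. cinner (app ((1 + cscale z a) ^ p * (a * t)) x) y"
    have eq: "cinner (app ((1 + cscale z a) ^ Suc p * t) x) y = ?F z + z * ?G z" for z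
      unfolding power_Suc2
      by (simp add: app_add_right app_scaleC_right cinner_simps)
    have "((\<lambda>z. ?F z + z * ?G z) has_field_derivative (f z + (1 * ?G z + g z * z))) (at z)" for z
      by (intro DERIV_add DERIV_mult DERIV_ident f(1) g)
    then show ?case
      by (intro exI[of _ "\<lambda>z. f z + (1 * ?G z + g z * z)"])
        (auto simp: eq f(2) distrib_right simp del: power_Suc app_plus app_times)
  qed
next
  case (Suc q)
  let ?F = "\<lambda>x z. cinner (app ((1 + cscale z a) ^ p * t * (1 - cscale z a) ^ q) x) y"
  obtain f where f: "\<And>z. (?F x has_field_derivative f z) (at z)"
    "f 0 = of_nat p * cinner (app (a * t) x) y - of_nat q * cinner (app (t * a) x) y"
    using Suc.IH[of x] by blast
  obtain g where g: "\<And>z. (?F (app a x) has_field_derivative g z) (at z)"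
    using Suc.IH[of "app a x"] by blast
  have eq: "cinner (app ((1 + cscale z a) ^ p * t * (1 - cscale z a) ^ Suc q) x) y
      = ?F x z - z * ?F (app a x) z" for z
    unfolding power_Suc2
    by (simp add: app_diff_right app_scaleC_right cinner_simps)
  have "((\<lambda>z. ?F x z - z * ?F (app a x) z) has_field_derivative
      (f z - (1 * ?F (app a x) z + g z * z))) (at z)" for z
    by (intro DERIV_diff DERIV_mult DERIV_ident f(1) g)
  then show ?case
    by (intro exI[of _ "\<lambda>z. f z - (1 * ?F (app a x) z + g z * z)"])
      (auto simp: eq f(2) distrib_right app_times[of t a] simp del: power_Suc app_times app_plus app_minus)
qed

lemma power_mult_distrib_commuting:
  fixes a b :: "'a::monoid_mult"
  assumes "a * b = b * a"
  shows "(a * b) ^ n = a ^ n * b ^ n"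
proof (induction n)
  case (Suc n)
  have "(a * b) ^ Suc n = a * (b * a ^ n) * b ^ n"
    by (simp add: Suc mult.assoc)
  also have "\<dots> = a ^ Suc n * b ^ Suc n"
    unfolding power_commuting[OF assms, symmetric] by (simp add: mult.assoc)
  finally show ?case .
qed simp

text \<open>The factor is unitary up to second order in \<open>s\<close>.\<close>

lemma op_bound_almost_unitary:
  fixes s r :: "'a::{complex_inner, complete_space} bop"
  assumes r: "r = star s" and comm: "s * r = r * s" and K: "op_bound K r"
  shows "op_bound (1 + K\<^sup>2) ((1 + r) * (1 - s))"
proof -
  define v where "v = (1 + r) * (1 - s)"
  have sr: "star r = s" using r by simp
  have c1: "(1 - r) * (1 - s) = (1 - s) * (1 - r)" "(1 + s) * (1 + r) = (1 + r) * (1 + s)"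
    using comm by (simp_all add: algebra_simps)
  have c2: "(1 - r) * (1 + s) = (1 + s) * (1 - r)" using comm by (simp add: algebra_simps)
  \<comment> \<open>As \<open>s\<close> and \<open>r\<close> commute, the factors can be reordered
    until each sum meets its difference. The linear terms cancel, and \<open>v\<close> changes norms
    exactly as \<open>1 - r * r\<close> does.\<close>
  have "star v * v = (1 - r) * ((1 + s) * (1 + r)) * (1 - s)"
    by (simp add: v_def sr r[symmetric] mult.assoc)
  also have "\<dots> = ((1 - r) * (1 + r)) * ((1 + s) * (1 - s))"
    unfolding c1(2) by (simp add: mult.assoc)
  also have "\<dots> = ((1 + r) * (1 - r)) * ((1 + s) * (1 - s))"
    by (simp add: algebra_simps)
  also have "\<dots> = (1 + r) * ((1 - r) * (1 + s)) * (1 - s)" by (simp add: mult.assoc)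
  also have "\<dots> = ((1 + r) * (1 + s)) * ((1 - r) * (1 - s))" by (simp add: c2 mult.assoc)
  also have "\<dots> = (1 + s) * ((1 + r) * (1 - s)) * (1 - r)"
    by (simp add: c1(1) c1(2)[symmetric] mult.assoc)
  also have "(1 + r) * (1 - s) = (1 - s) * (1 + r)" using comm by (simp add: algebra_simps)
  also have "(1 + s) * ((1 - s) * (1 + r)) * (1 - r) = (1 - s * s) * (1 - r * r)"
    by (simp add: algebra_simps)
  finally have vv: "star v * v = star (1 - r * r) * (1 - r * r)" by (simp add: sr)
  have bd: "op_bound (1 + K * K) (1 - r * r)"
    by (intro op_bound_diff op_bound_one op_bound_mult K)
  have norm_eq: "norm (app v x) = norm (app (1 - r * r) x)" for x
  proof -
    have "(norm (app v x))\<^sup>2 = Re (cinner (app (star v * v) x) x)"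
      by (simp add: Re_cinner_self[symmetric] cinner_star)
    also have "\<dots> = (norm (app (1 - r * r) x))\<^sup>2"
      unfolding vv app_times[of "star (1 - r * r)"] Re_cinner_self[symmetric] cinner_star star_star ..
    finally show ?thesis by simp
  qed
  show ?thesis
    using bd unfolding op_bound_def v_def[symmetric] norm_eq power2_eq_square by blast
qed

theorem fuglede:
  fixes n t :: "'a::{complex_inner, complete_space} bop"
  assumes normal: "n * star n = star n * n" and comm: "t * n = n * t"
  shows "t * star n = star n * t"
proof -
  obtain K where K: "op_bound K n" using op_bound_exists by blast
  obtain L where L: "op_bound L (star n)" using op_bound_exists by blast
  obtain M where M: "op_bound M t" using op_bound_exists by blast
  have K0: "0 \<le> K" using K by (rule op_bound_nonneg)
  define F where "F m z x y = cinner (app ((1 + cscale z (cscale (1 / of_nat m) (star n))) ^ m * t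
      * (1 - cscale z (cscale (1 / of_nat m) (star n))) ^ m) x) y" for m z x y
  \<comment> \<open>The first summand bounds \<open>t\<close> between almost unitary factors. The
    second is the error made because (1 - r)^m (1 + r)^m is not exactly 1. For fixed
    \<open>R\<close> the sum tends to \<open>M\<close>.\<close>
  define C where "C R m = (1 + (R * K / real m)\<^sup>2) ^ m * M * (1 + (R * K / real m)\<^sup>2) ^ m
      + (1 + R * L / real m) ^ m * (M * ((1 + (R * K / real m)\<^sup>2) ^ m - 1)) * (1 + R * L / real m) ^ m"
    for R m
  have bound: "cmod (F m z x y) \<le> C R m * norm x * norm y" if z: "cmod z = R" for m z x y R
  proof -
    define s where "s = cscale z (cscale (1 / of_nat m) (star n))"
    define r where "r = star s"
    have r_eq: "r = cscale (cnj z) (cscale (1 / of_nat m) n)" by (simp add: r_def s_def)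
    have s1: "s = cscale (z / of_nat m) (star n)" and r1: "r = cscale (cnj z / of_nat m) n"
      unfolding s_def r_eq by (simp_all add: cscale_cscale)
    have sr: "s * r = r * s" unfolding s1 r1
      by (simp add: cscale_mult_left cscale_mult_right cscale_cscale normal mult.commute)
    have tr: "t * r = r * t" unfolding r1 by (simp add: cscale_mult_left cscale_mult_right comm)
    have bs: "op_bound (R * L / real m) s"
      using op_bound_cscale[OF L, of "z / of_nat m"] z by (simp add: s1 norm_divide)
    have br: "op_bound (R * K / real m) r"
      using op_bound_cscale[OF K, of "cnj z / of_nat m"] z by (simp add: r1 norm_divide)
    let ?e = "(R * K / real m)\<^sup>2"
    have V: "op_bound (1 + ?e) ((1 + r) * (1 - s))"
      by (rule op_bound_almost_unitary[OF r_def sr br])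
    have W: "op_bound (1 + ?e) ((1 - r) * (1 + s))"
      using op_bound_almost_unitary[of "- r" "- s", OF _ _ op_bound_uminus[OF br]] sr
      by (simp add: r_def)
    have c1: "(1 + r) * (1 - s) = (1 - s) * (1 + r)" "(1 - r) * (1 + s) = (1 + s) * (1 - r)"
      using sr by (simp_all add: algebra_simps)
    have V': "((1 + r) * (1 - s)) ^ m = (1 + r) ^ m * (1 - s) ^ m"
      by (rule power_mult_distrib_commuting[OF c1(1)])
    have W': "((1 - r) * (1 + s)) ^ m = (1 + s) ^ m * (1 - r) ^ m"
      unfolding c1(2) by (rule power_mult_distrib_commuting[OF c1(2)[symmetric]])
    have tr': "(1 - r) ^ m * t = t * (1 - r) ^ m"
      by (rule power_commuting) (simp add: algebra_simps tr)
    have rr: "(1 - r) ^ m * (1 + r) ^ m = (1 - r * r) ^ m"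
      by (subst power_mult_distrib_commuting[symmetric]) (auto simp: algebra_simps)
    \<comment> \<open>The powers of \<open>1 - r\<close> pass through \<open>t\<close> because
      \<open>r\<close> is a multiple of \<open>n\<close>; they then meet those of
      \<open>1 + r\<close>.\<close>
    have "((1 - r) * (1 + s)) ^ m * t * ((1 + r) * (1 - s)) ^ m
        = (1 + s) ^ m * ((1 - r) ^ m * t) * ((1 + r) ^ m * (1 - s) ^ m)"
      unfolding V' W' by (simp only: mult.assoc)
    also have "\<dots> = (1 + s) ^ m * t * ((1 - r) ^ m * (1 + r) ^ m) * (1 - s) ^ m"
      unfolding tr' by (simp only: mult.assoc)
    also have "\<dots> = (1 + s) ^ m * t * (1 - s) ^ m
        + (1 + s) ^ m * (t * ((1 - r * r) ^ m - 1)) * (1 - s) ^ m"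
      unfolding rr by (simp add: algebra_simps)
    finally have eq: "(1 + s) ^ m * t * (1 - s) ^ m
        = ((1 - r) * (1 + s)) ^ m * t * ((1 + r) * (1 - s)) ^ m
          - (1 + s) ^ m * (t * ((1 - r * r) ^ m - 1)) * (1 - s) ^ m"
      by (simp add: algebra_simps)
    have b2: "op_bound ?e (r * r)"
      using op_bound_mult[OF br br] by (simp add: power2_eq_square)
    have "op_bound (C R m) ((1 + s) ^ m * t * (1 - s) ^ m)"
      unfolding eq C_def
      by (intro op_bound_diff op_bound_mult op_bound_power V W M op_bound_power_diff_one[OF b2]
          op_bound_add op_bound_one bs)
    then show ?thesis unfolding F_def s_def[symmetric] by (rule op_bound_cinner)
  qed
  have Clim: "(\<lambda>m. C R m) \<longlonglongrightarrow> M" if "R > 0" for R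
  proof -
    have l1: "(\<lambda>m. (1 + (R * K / real m)\<^sup>2) ^ m) \<longlonglongrightarrow> 1"
      by (cases "K = 0") (use that K0 in \<open>simp, real_asymp\<close>)
    have l2: "(\<lambda>m. (1 + R * L / real m) ^ m) \<longlonglongrightarrow> exp (R * L)"
      by (rule tendsto_exp_limit_sequentially)
    have "(\<lambda>m. C R m) \<longlonglongrightarrow> 1 * M * 1 + exp (R * L) * (M * (1 - 1)) * exp (R * L)"
      unfolding C_def by (intro tendsto_intros l1 l2)
    then show ?thesis by simp
  qed
  have der: "cmod (cinner (app (star n * t - t * star n) x) y) \<le> C R m * norm x * norm y / R"
    if R: "R > 0" and m: "m > 0" for R m x y
  proof -
    obtain f' where f': "\<And>z. ((\<lambda>z. F m z x y) has_field_derivative f' z) (at z)"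
      "f' 0 = of_nat m * cinner (app (cscale (1 / of_nat m) (star n) * t) x) y
        - of_nat m * cinner (app (t * cscale (1 / of_nat m) (star n)) x) y"
      using has_derivative_pencil[of "cscale (1 / of_nat m) (star n)" m t m x y]
      unfolding F_def by blast
    have "f' 0 = cinner (app (star n * t - t * star n) x) y"
      using m by (simp add: f'(2) cinner_simps app_scaleC_right)
    moreover have "deriv (\<lambda>z. F m z x y) 0 = f' 0" by (rule DERIV_imp_deriv[OF f'(1)])
    moreover have "norm ((deriv ^^ 1) (\<lambda>z. F m z x y) 0)
        \<le> fact 1 * (C R m * norm x * norm y) / R ^ 1"
    proof (rule Cauchy_inequality)
      show "(\<lambda>z. F m z x y) holomorphic_on ball 0 R"
        using f'(1) by (meson has_field_derivative_at_within holomorphic_on_def field_differentiable_def)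
      show "continuous_on (cball 0 R) (\<lambda>z. F m z x y)"
        by (rule DERIV_continuous_on[OF has_field_derivative_at_within[OF f'(1)]])
      show "norm (F m z x y) \<le> C R m * norm x * norm y" if "norm (0 - z) = R" for z
        using bound[of z R m x y] that by simp
    qed (rule R)
    ultimately show ?thesis by simp
  qed
  have zero: "cinner (app (star n * t - t * star n) x) y = 0" for x y
  proof -
    let ?d = "cmod (cinner (app (star n * t - t * star n) x) y)"
    have "?d \<le> M * norm x * norm y / R" if R: "R > 0" for R
    proof (rule LIMSEQ_le_const)
      show "(\<lambda>m. C R m * norm x * norm y / R) \<longlonglongrightarrow> M * norm x * norm y / R"
        by (intro tendsto_intros Clim R) (use R in simp)
      show "\<exists>N. \<forall>m\<ge>N. ?d \<le> C R m * norm x * norm y / R"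
        by (intro exI[of _ 1] allI impI der R) simp
    qed
    moreover have "((\<lambda>R. M * norm x * norm y / R) \<longlongrightarrow> 0) at_top"
      by (rule real_tendsto_divide_at_top[OF tendsto_const filterlim_ident])
    ultimately have "?d \<le> 0"
      by (intro tendsto_lowerbound) (auto intro: eventually_mono[OF eventually_gt_at_top[of 0]])
    then show ?thesis by simp
  qed
  have "app (star n * t - t * star n) x = 0" for x
    using zero[of x "app (star n * t - t * star n) x"] by (simp only: cinner_self_eq_zero)
  then have "star n * t - t * star n = 0" by (intro bop_eqI) (simp only: app_zero)
  then show ?thesis by simp
qed

section \<open>Positive operators\<close>

text \<open>Only the real part of the form is constrained, which does not force self-adjointness;
  hence the first conjunct.\<close>

definition positive :: "'a::{complex_inner, complete_space} bop \<Rightarrow> bool" where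
  "positive a \<longleftrightarrow> star a = a \<and> (\<forall>x. 0 \<le> Re (cinner (app a x) x))"

lemma positive_star: "positive a \<Longrightarrow> star a = a"
  by (simp add: positive_def)

lemma positive_form: "positive a \<Longrightarrow> 0 \<le> Re (cinner (app a x) x)"
  by (simp add: positive_def)

lemma positive_zero [simp]: "positive 0"
  by (simp add: positive_def)

lemma positive_one [simp]: "positive 1"
  by (simp add: positive_def cinner_self_nonneg)

lemma positive_add: "positive a \<Longrightarrow> positive b \<Longrightarrow> positive (a + b)"
  by (simp add: positive_def cinner_simps)

lemma positive_scaleR: "0 \<le> r \<Longrightarrow> positive a \<Longrightarrow> positive (r *\<^sub>R a)"
  by (simp add: positive_def cinner_simps)

lemma positive_conjugate: "positive q \<Longrightarrow> positive (star a * q * a)"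
  by (simp add: positive_def mult.assoc cinner_star) (metis cinner_star)

lemma positive_star_mult: "positive (star a * a)"
  using positive_conjugate[OF positive_one, of a] by simp

lemma positive_square: "star a = a \<Longrightarrow> positive (a * a)"
  using positive_star_mult[of a] by simp

lemma positive_Cauchy_Schwarz:
  assumes "positive q"
  shows "(Re (cinner (app q x) y))\<^sup>2 \<le> Re (cinner (app q x) x) * Re (cinner (app q y) y)"
proof (rule discriminant_le)
  have sym: "Re (cinner (app q y) x) = Re (cinner (app q x) y)"
    using assms by (metis Re_cinner_commute cinner_star positive_star)
  fix t :: real
  have "0 \<le> Re (cinner (app q (x + t *\<^sub>R y)) (x + t *\<^sub>R y))"
    by (rule positive_form[OF assms])
  then show "0 \<le> Re (cinner (app q x) x) + 2 * t * Re (cinner (app q x) y)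
      + t\<^sup>2 * Re (cinner (app q y) y)"
    by (simp add: app_add_right app_scaleR_right cinner_simps sym algebra_simps power2_eq_square)
qed (rule positive_form[OF assms])

text \<open>Log-convexity makes the ratios of successive terms nondecreasing, so a first ratio above
  1 would force geometric growth.\<close>

lemma log_convex_bounded_le:
  fixes s :: "nat \<Rightarrow> real"
  assumes nonneg: "\<And>k. 0 \<le> s k" and bounded: "\<And>k. s k \<le> L"
    and convex: "\<And>k. (s (Suc k))\<^sup>2 \<le> s k * s (Suc (Suc k))"
  shows "s 1 \<le> s 0"
proof (rule ccontr)
  assume "\<not> s 1 \<le> s 0"
  then have less: "s 0 < s 1" by simp
  have "s 0 \<noteq> 0"
  proof
    assume "s 0 = 0"
    then have "s 1 = 0" using convex[of 0] by simp
    then show False using less nonneg[of 0] by simp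
  qed
  then have s0: "0 < s 0" using nonneg[of 0] by simp
  define r where "r = s 1 / s 0"
  have r: "1 < r" using less s0 by (simp add: r_def)
  have step: "0 < s k \<and> r * s k \<le> s (Suc k)" for k
  proof (induction k)
    case 0
    show ?case using s0 by (simp add: r_def)
  next
    case (Suc k)
    have pos: "0 < s (Suc k)" using Suc r by (smt (verit) mult_pos_pos)
    have "s k * (r * s (Suc k)) \<le> (s (Suc k))\<^sup>2"
      using mult_right_mono[OF conjunct2[OF Suc], of "s (Suc k)"] pos
      by (simp add: power2_eq_square mult_ac)
    also have "\<dots> \<le> s k * s (Suc (Suc k))" by (rule convex)
    finally show ?case using Suc pos by simp
  qed
  have growth: "r ^ k * s 0 \<le> s k" for k
  proof (induction k)
    case (Suc k)
    have "r * (r ^ k * s 0) \<le> r * s k" using Suc r by simp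
    then show ?case using step[of k] by simp
  qed simp
  obtain k where "L / s 0 < r ^ k" using real_arch_pow[OF r] by blast
  then have "L < r ^ k * s 0" using s0 by (simp add: field_simps)
  then show False using growth[of k] bounded[of k] by linarith
qed

text \<open>Avoids a square root of \<open>q\<close>. Along the orbit of \<open>x\<close> under
  \<open>a\<close> the values of the form of \<open>q\<close> are bounded, as \<open>a\<close> is a
  contraction. They are log-convex by Cauchy-Schwarz for \<open>q\<close>, because the mixed term
  between the orbit points \<open>k\<close> and \<open>k + 2\<close> is the value at
  \<open>k + 1\<close>. So the first value is at most the zeroth.\<close>

lemma positive_contraction_diff:
  assumes q: "positive q" and a: "star a = a" and comm: "q * a = a * q"
    and contr: "\<And>x. norm (app a x) \<le> norm x"
  shows "positive (q - a * q * a)"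
  unfolding positive_def
proof (intro conjI allI)
  show "star (q - a * q * a) = q - a * q * a"
    using positive_star[OF q] a by (simp add: mult.assoc)
  fix x
  define s where "s k = Re (cinner (app q (app (a ^ k) x)) (app (a ^ k) x))" for k
  have comm': "app a (app q y) = app q (app a y)" for y
    using comm by (metis app_times)
  have shift: "cinner (app q y) (app a (app a y)) = cinner (app q (app a y)) (app a y)" for y
    using a comm'[of y] by (metis cinner_star)
  obtain K where K: "op_bound K q" using op_bound_exists by blast
  have small: "norm (app (a ^ k) x) \<le> norm x" for k
    by (induction k) (auto intro: order_trans[OF contr])
  have "s 1 \<le> s 0"
  proof (rule log_convex_bounded_le)
    show "0 \<le> s k" for k unfolding s_def by (rule positive_form[OF q])
    show "(s (Suc k))\<^sup>2 \<le> s k * s (Suc (Suc k))" for k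
      using positive_Cauchy_Schwarz[OF q, of "app (a ^ k) x" "app (a ^ Suc (Suc k)) x"]
      by (simp add: s_def shift)
    show "s k \<le> K * (norm x * norm x)" for k
    proof -
      have "s k \<le> norm (app q (app (a ^ k) x)) * norm (app (a ^ k) x)"
        unfolding s_def by (rule Re_cinner_le)
      also have "\<dots> \<le> K * norm (app (a ^ k) x) * norm (app (a ^ k) x)"
        by (rule mult_right_mono[OF op_boundD[OF K]]) simp
      also have "\<dots> \<le> K * (norm x * norm x)"
        unfolding mult.assoc
        by (intro mult_left_mono mult_mono small op_bound_nonneg[OF K]) auto
      finally show ?thesis .
    qed
  qed
  then show "0 \<le> Re (cinner (app (q - a * q * a) x) x)"
    using a by (simp add: s_def cinner_simps) (metis cinner_star)
qed

text \<open>The product theorem for commuting positive operators rests on this lemma, so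
  \<open>a - a * a\<close> is split into two conjugates of positive operators instead.\<close>

lemma positive_one_minus_square:
  assumes "positive a" "positive (1 - a)"
  shows "positive (1 - a * a)"
proof -
  have "positive ((1 - a) + (star a * (1 - a) * a + star (1 - a) * a * (1 - a)))"
    by (intro positive_add positive_conjugate assms)
  also have "(1 - a) + (star a * (1 - a) * a + star (1 - a) * a * (1 - a)) = 1 - a * a"
    using positive_star[OF assms(1)] by (simp add: algebra_simps)
  finally show ?thesis .
qed

lemma Re_cinner_one_minus_square:
  "Re (cinner (app (1 - a * a) x) x) = (norm x)\<^sup>2 - Re (cinner (app a (app a x)) x)"
  by (simp add: cinner_simps Re_cinner_self)

text \<open>With \<open>a = 1 - g\<close> one has \<open>2 g q = (q - a q a) + g q g\<close>.\<close>

lemma positive_mult: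
  assumes q: "positive q" and g: "positive g" "positive (1 - g)" and comm: "q * g = g * q"
  shows "positive (g * q)"
proof -
  let ?a = "1 - g"
  have a: "star ?a = ?a" by (rule positive_star[OF g(2)])
  have contr: "norm (app ?a x) \<le> norm x" for x
  proof -
    have "positive (1 - ?a * ?a)" by (rule positive_one_minus_square) (use g in auto)
    then have "Re (cinner (app ?a (app ?a x)) x) \<le> (norm x)\<^sup>2"
      using positive_form[of "1 - ?a * ?a" x] unfolding Re_cinner_one_minus_square by linarith
    then have "(norm (app ?a x))\<^sup>2 \<le> (norm x)\<^sup>2"
      by (subst (asm) cinner_star) (simp only: a Re_cinner_self)
    then show ?thesis by simp
  qed
  have "positive ((1/2) *\<^sub>R ((q - ?a * q * ?a) + star g * q * g))"
    by (intro positive_scaleR positive_add positive_contraction_diff positive_conjugate q a contr)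
      (auto simp: algebra_simps comm)
  moreover have "(q - ?a * q * ?a) + star g * q * g = 2 *\<^sub>R (g * q)"
    using positive_star[OF g(1)] comm by (simp add: algebra_simps scaleR_2)
  ultimately show ?thesis by simp
qed

section \<open>Bernstein operators\<close>

text \<open>\<open>bern g m F\<close> is the sum over \<open>i \<le> m\<close> of \<open>(m choose i) g\<^sup>i (1 - g)\<^sup>m\<^sup>-\<^sup>i F\<^sub>i\<close>.\<close>

fun bern :: "'a::complex_inner bop \<Rightarrow> nat \<Rightarrow> (nat \<Rightarrow> 'a bop) \<Rightarrow> 'a bop" where
  "bern g 0 F = F 0"
| "bern g (Suc m) F = g * bern g m (\<lambda>i. F (Suc i)) + (1 - g) * bern g m F"

lemma commute_mult:
  fixes a b t :: "'a::semigroup_mult"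
  shows "a * t = t * a \<Longrightarrow> b * t = t * b \<Longrightarrow> (a * b) * t = t * (a * b)"
  by (metis mult.assoc)

lemma bern_commute:
  assumes "\<And>i. F i * t = t * F i" "g * t = t * g"
  shows "bern g m F * t = t * bern g m F"
  using assms(1)
proof (induction m arbitrary: F)
  case (Suc m)
  have "bern g m (\<lambda>i. F (Suc i)) * t = t * bern g m (\<lambda>i. F (Suc i))"
    "bern g m F * t = t * bern g m F"
    by (intro Suc.IH Suc.prems)+
  moreover have "(1 - g) * t = t * (1 - g)" using assms(2) by (simp add: algebra_simps)
  ultimately show ?case
    unfolding bern.simps distrib_left distrib_right
    by (intro arg_cong2[where f = "(+)"] commute_mult assms(2))
qed simp

text \<open>Each recursion step multiplies by \<open>g\<close> or \<open>1 - g\<close>, so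
  \<open>positive_mult\<close> applies. This carries inequalities at the nodes i/m over to
  operators, with operator coefficients allowed, and so does the work of a functional
  calculus.\<close>

lemma positive_bern:
  assumes g: "positive g" "positive (1 - g)"
    and F: "\<And>i. i \<le> m \<Longrightarrow> positive (F i)" "\<And>i. F i * g = g * F i"
  shows "positive (bern g m F)"
  using F
proof (induction m arbitrary: F)
  case (Suc m)
  have c: "bern g m (\<lambda>i. F (Suc i)) * g = g * bern g m (\<lambda>i. F (Suc i))"
    "bern g m F * g = g * bern g m F"
    by (intro bern_commute Suc.prems refl)+
  have "positive (g * bern g m (\<lambda>i. F (Suc i)))"
    by (intro positive_mult g c Suc.IH) (use Suc.prems in auto)
  moreover have "positive ((1 - g) * bern g m F)"
  proof (rule positive_mult)
    show "positive (bern g m F)" by (rule Suc.IH) (use Suc.prems in auto)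
    show "bern g m F * (1 - g) = (1 - g) * bern g m F" using c(2) by (simp add: algebra_simps)
  qed (use g in auto)
  ultimately show ?case by (simp add: positive_add)
qed simp

lemma bern_add: "bern g m (\<lambda>i. F i + G i) = bern g m F + bern g m G"
  by (induction m arbitrary: F G) (simp_all add: algebra_simps)

lemma bern_scaleR: "bern g m (\<lambda>i. r *\<^sub>R F i) = r *\<^sub>R bern g m F"
  by (induction m arbitrary: F) (simp_all add: algebra_simps)

lemma bern_diff: "bern g m (\<lambda>i. F i - G i) = bern g m F - bern g m G"
  using bern_add[of g m F "\<lambda>i. (-1) *\<^sub>R G i"] unfolding bern_scaleR by simp

lemma bern_mult_right: "bern g m (\<lambda>i. F i * a) = bern g m F * a"
  by (induction m arbitrary: F) (simp_all add: algebra_simps)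

lemma bern_const: "bern g m (\<lambda>i. a) = a"
  by (induction m) (simp_all add: algebra_simps)

text \<open>The Bernstein polynomial, evaluated at \<open>g\<close>, of a scalar function whose
  value at the node i/m is \<open>f i\<close>.\<close>

definition bern_fun :: "'a::complex_inner bop \<Rightarrow> nat \<Rightarrow> (nat \<Rightarrow> real) \<Rightarrow> 'a bop" where
  "bern_fun g m f = bern g m (\<lambda>i. f i *\<^sub>R 1)"

lemma bern_fun_mult: "bern g m (\<lambda>i. f i *\<^sub>R a) = bern_fun g m f * a"
  using bern_mult_right[of g m "\<lambda>i. f i *\<^sub>R 1" a] by (simp add: bern_fun_def)

lemma bern_fun_scale: "bern_fun g m (\<lambda>i. c * f i) = c *\<^sub>R bern_fun g m f"
  using bern_scaleR[of g m c "\<lambda>i. f i *\<^sub>R 1"] by (simp add: bern_fun_def)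

lemma bern_fun_commute: "g * t = t * g \<Longrightarrow> bern_fun g m f * t = t * bern_fun g m f"
  unfolding bern_fun_def by (rule bern_commute) auto

lemma star_bern_fun:
  assumes "star g = g" shows "star (bern_fun g m f) = bern_fun g m f"
proof -
  have "star (bern g m (\<lambda>i. f i *\<^sub>R 1)) = bern g m (\<lambda>i. f i *\<^sub>R 1)"
  proof (induction m arbitrary: f)
    case (Suc m)
    have *: "bern g m (\<lambda>i. f i *\<^sub>R 1) * g = g * bern g m (\<lambda>i. f i *\<^sub>R 1)" for f
      by (rule bern_commute) auto
    show ?case
      using assms *[of f] *[of "\<lambda>i. f (Suc i)"] Suc.IH[of f] Suc.IH[of "\<lambda>i. f (Suc i)"]
      by (simp add: algebra_simps)
  qed simp
  then show ?thesis by (simp add: bern_fun_def)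
qed

lemma bern_moment1: "bern g m (\<lambda>i. real i *\<^sub>R 1) = real m *\<^sub>R g"
proof (induction m)
  case (Suc m)
  have "bern g m (\<lambda>i. real (Suc i) *\<^sub>R 1) = real m *\<^sub>R g + 1"
    using Suc by (simp add: scaleR_left_distrib bern_add bern_const)
  then show ?case using Suc by (simp add: algebra_simps)
qed simp

text \<open>The second moment of a binomial variable with success probability \<open>g\<close>.
  After division by m^2 it exceeds \<open>g * g\<close> by the variance (g - g^2)/m, the source of
  the rate in the approximation below.\<close>

lemma bern_moment2:
  "bern g m (\<lambda>i. (real i)\<^sup>2 *\<^sub>R 1) = (real m * (real m - 1)) *\<^sub>R (g * g) + real m *\<^sub>R g"
proof (induction m)
  case (Suc m)
  have "(real (Suc i))\<^sup>2 = (real i)\<^sup>2 + (real i + real i) + 1" for i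
    by (simp add: power2_eq_square algebra_simps)
  then have M: "bern g m (\<lambda>i. (real (Suc i))\<^sup>2 *\<^sub>R 1)
      = (real m * (real m - 1)) *\<^sub>R (g * g) + real m *\<^sub>R g + (real m *\<^sub>R g + real m *\<^sub>R g) + 1"
    using Suc by (simp only: scaleR_left_distrib scaleR_one bern_add bern_const bern_moment1)
  show ?case
    unfolding bern.simps M Suc by (simp add: algebra_simps)
qed simp

lemma bern_fun_id: "m > 0 \<Longrightarrow> bern_fun g m (\<lambda>i. real i / real m) = g"
  using bern_fun_scale[of g m "1 / real m" real] by (simp add: bern_fun_def bern_moment1)

lemma bern_fun_square:
  assumes "m > 0"
  shows "bern_fun g m (\<lambda>i. (real i / real m)\<^sup>2) = g * g + (1 / real m) *\<^sub>R (g - g * g)"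
proof -
  have "bern_fun g m (\<lambda>i. (real i / real m)\<^sup>2)
      = (1 / (real m)\<^sup>2) *\<^sub>R ((real m * (real m - 1)) *\<^sub>R (g * g) + real m *\<^sub>R g)"
    using bern_fun_scale[of g m "1 / (real m)\<^sup>2" "\<lambda>i. (real i)\<^sup>2"]
    by (simp add: bern_fun_def bern_moment2 power_divide)
  also have "\<dots> = (1 / (real m)\<^sup>2 * (real m * (real m - 1))) *\<^sub>R (g * g)
      + (1 / (real m)\<^sup>2 * real m) *\<^sub>R g"
    by (simp only: scaleR_right_distrib scaleR_scaleR)
  also have "\<dots> = (1 - 1 / real m) *\<^sub>R (g * g) + (1 / real m) *\<^sub>R g"
    using assms by (intro arg_cong2[where f = "\<lambda>r s. r *\<^sub>R (g * g) + s *\<^sub>R g"])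
      (simp_all add: power2_eq_square field_simps)
  also have "\<dots> = g * g + (1 / real m) *\<^sub>R (g - g * g)"
    by (simp add: scaleR_left_diff_distrib scaleR_right_diff_distrib)
  finally show ?thesis .
qed

text \<open>Multiplying symbols is multiplicative up to \<open>O(1/\<surd>m)\<close> (take \<open>d\<^sup>2 = 1/\<surd>m\<close>): apply
  \<open>bern\<close> to the squares \<open>(d f\<^sub>i + (g - i/m)/d)\<^sup>2\<close>.\<close>

lemma bern_fun_mult_id_approx:
  assumes g: "positive g" "positive (1 - g)" and m: "m > 0" and d: "d > 0"
    and f: "\<And>i. i \<le> m \<Longrightarrow> \<bar>f i\<bar> \<le> M"
  shows "positive (2 *\<^sub>R (g * bern_fun g m f - bern_fun g m (\<lambda>i. f i * (real i / real m)))
    + (d\<^sup>2 * M\<^sup>2 + 1 / (d\<^sup>2 * real m)) *\<^sub>R 1)"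
proof -
  let ?x = "\<lambda>i. real i / real m"
  define G where "G i = (d * f i) *\<^sub>R 1 + (1 / d) *\<^sub>R (g - ?x i *\<^sub>R 1)" for i
  have sg: "star g = g" by (rule positive_star[OF g(1)])
  have comm: "bern_fun g m f * g = g * bern_fun g m f" for f by (rule bern_fun_commute) simp
  have GG: "G i * G i = d\<^sup>2 *\<^sub>R ((f i)\<^sup>2 *\<^sub>R 1) + ((f i *\<^sub>R g + f i *\<^sub>R g) - ((f i * ?x i) *\<^sub>R 1 + (f i * ?x i) *\<^sub>R 1))
      + (1 / d\<^sup>2) *\<^sub>R (g * g - (?x i *\<^sub>R g + ?x i *\<^sub>R g) + (?x i)\<^sup>2 *\<^sub>R 1)" for i
    using d by (simp add: G_def algebra_simps power2_eq_square scaleR_2)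
  have "positive (bern g m (\<lambda>i. G i * G i))"
  proof (rule positive_bern[OF g])
    show "positive (G i * G i)" for i by (rule positive_square) (simp add: G_def sg)
    have "G i * g = g * G i" for i by (simp add: G_def algebra_simps)
    then show "G i * G i * g = g * (G i * G i)" for i by (intro commute_mult)
  qed
  also have "bern g m (\<lambda>i. G i * G i) = d\<^sup>2 *\<^sub>R bern_fun g m (\<lambda>i. (f i)\<^sup>2)
      + 2 *\<^sub>R (bern_fun g m f * g - bern_fun g m (\<lambda>i. f i * ?x i))
      + (1 / d\<^sup>2) *\<^sub>R (g * g - 2 *\<^sub>R (g * g) + (g * g + (1 / real m) *\<^sub>R (g - g * g)))"
    unfolding GG bern_add bern_diff bern_scaleR bern_fun_mult bern_const

    by (simp add: bern_fun_id[OF m, unfolded bern_fun_def] scaleR_2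
        bern_fun_square[OF m, unfolded bern_fun_def] bern_fun_def)
  also have "(1 / d\<^sup>2) *\<^sub>R (g * g - 2 *\<^sub>R (g * g) + (g * g + (1 / real m) *\<^sub>R (g - g * g)))
      = (1 / (d\<^sup>2 * real m)) *\<^sub>R (g - g * g)"
    by (simp add: scaleR_2)
  finally have 1: "positive (d\<^sup>2 *\<^sub>R bern_fun g m (\<lambda>i. (f i)\<^sup>2)
      + 2 *\<^sub>R (bern_fun g m f * g - bern_fun g m (\<lambda>i. f i * ?x i))
      + (1 / (d\<^sup>2 * real m)) *\<^sub>R (g - g * g))" .
  have "positive (bern g m (\<lambda>i. M\<^sup>2 *\<^sub>R 1 - (f i)\<^sup>2 *\<^sub>R 1))"
  proof (rule positive_bern[OF g])
    fix i assume "i \<le> m"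
    then have "(f i)\<^sup>2 \<le> M\<^sup>2" using power_mono[OF f, of i 2] by simp
    then show "positive (M\<^sup>2 *\<^sub>R 1 - (f i)\<^sup>2 *\<^sub>R (1 :: 'a bop))"
      using positive_scaleR[of "M\<^sup>2 - (f i)\<^sup>2" 1] by (simp add: scaleR_left_diff_distrib)
  qed (simp add: algebra_simps)
  then have 2: "positive (M\<^sup>2 *\<^sub>R 1 - bern_fun g m (\<lambda>i. (f i)\<^sup>2))"
    by (simp add: bern_diff bern_const bern_fun_def)
  \<comment> \<open>This is what \<open>g - g * g\<close> lacks to be 1, so adding it leaves a
    scalar error.\<close>
  have 3: "positive ((1 - g) + g * g)" by (intro positive_add g positive_square sg)
  have "positive ((d\<^sup>2 *\<^sub>R bern_fun g m (\<lambda>i. (f i)\<^sup>2)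
      + 2 *\<^sub>R (bern_fun g m f * g - bern_fun g m (\<lambda>i. f i * ?x i))
      + (1 / (d\<^sup>2 * real m)) *\<^sub>R (g - g * g))
      + (d\<^sup>2 *\<^sub>R (M\<^sup>2 *\<^sub>R 1 - bern_fun g m (\<lambda>i. (f i)\<^sup>2))
      + (1 / (d\<^sup>2 * real m)) *\<^sub>R ((1 - g) + g * g)))"
    by (intro positive_add positive_scaleR 1 2 3) auto
  then show ?thesis
    by (simp add: comm algebra_simps flip: scaleR_add_left)
qed

section \<open>Commutation with the root of a positive operator\<close>

text \<open>At \<open>c = 1\<close> the inequality says nothing about \<open>v\<close>. For
  \<open>c > 1\<close> the factor \<open>1 - c ^ N\<close> is negative and \<open>v\<close> is
  bounded above by \<open>c * u m\<close> up to a multiple of \<open>\<eta> m\<close>; for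
  \<open>c < 1\<close> it is bounded below in the same way. With \<open>c\<close> fixed close to 1
  the error vanishes in the limit, and \<open>L\<close> controls the difference between
  \<open>c * u m\<close> and \<open>u m\<close>.\<close>

lemma tendsto_of_scaled_bounds:
  fixes u \<eta> :: "nat \<Rightarrow> real"
  assumes N: "N \<ge> 1" and \<eta>: "\<eta> \<longlonglongrightarrow> 0" and bd: "\<And>m. m > 0 \<Longrightarrow> \<bar>u m\<bar> \<le> L"
    and ineq: "\<And>c m. m > 0 \<Longrightarrow> c \<ge> 0 \<Longrightarrow> 0 \<le> (1 - c ^ N) * (v - c * u m) + c ^ Suc N * \<eta> m"
  shows "u \<longlonglongrightarrow> v"
proof (rule LIMSEQ_I)
  fix e :: real assume e: "e > 0"
  have L: "0 \<le> L" using bd[of 1] by linarith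
  \<comment> \<open>The cap 1/2 keeps \<open>1 - \<delta>\<close> positive; the other term gives
    \<open>\<delta> * L < e / 2\<close>, with \<open>L + 1\<close> to allow
    \<open>L = 0\<close>.\<close>
  define \<delta> where "\<delta> = min (1/2) (e / (2 * (L + 1)))"
  have \<delta>: "0 < \<delta>" "\<delta> < 1" "\<delta> * L < e / 2"
  proof -
    show "0 < \<delta>" "\<delta> < 1" using e L by (auto simp: \<delta>_def)
    have "\<delta> * L \<le> e / (2 * (L + 1)) * L" using L by (intro mult_right_mono) (auto simp: \<delta>_def)
    also have "\<dots> < e / 2" using e L by (simp add: field_simps)
    finally show "\<delta> * L < e / 2" .
  qed
  define a where "a = 1 + \<delta>" define b where "b = 1 - \<delta>"
  have a: "0 < a ^ N - 1" and b: "0 < 1 - b ^ N"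
    using \<delta> N one_less_power[of a N] power_Suc_less_one[of b "N - 1"]
    by (auto simp: a_def b_def)
  have "(\<lambda>m. a ^ Suc N * \<eta> m / (a ^ N - 1)) \<longlonglongrightarrow> a ^ Suc N * 0 / (a ^ N - 1)"
    by (intro tendsto_intros \<eta>) (use a in simp)
  then have "eventually (\<lambda>m. a ^ Suc N * \<eta> m / (a ^ N - 1) < e / 2) sequentially"
    by (rule order_tendstoD) (use e in simp)
  moreover have "(\<lambda>m. b ^ Suc N * \<eta> m / (1 - b ^ N)) \<longlonglongrightarrow> b ^ Suc N * 0 / (1 - b ^ N)"
    by (intro tendsto_intros \<eta>) (use b in simp)
  then have "eventually (\<lambda>m. b ^ Suc N * \<eta> m / (1 - b ^ N) < e / 2) sequentially"
    by (rule order_tendstoD) (use e in simp)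
  ultimately have "eventually (\<lambda>m. norm (u m - v) < e) sequentially"
    using eventually_gt_at_top[of 0]
  proof eventually_elim
    case (elim m)
    have "\<bar>\<delta> * u m\<bar> \<le> \<delta> * L" using bd[OF elim(3)] \<delta> by (simp add: abs_mult)
    then have small: "\<bar>\<delta> * u m\<bar> < e / 2" using \<delta> by linarith
    have "(a ^ N - 1) * (v - a * u m) \<le> a ^ Suc N * \<eta> m"
      using ineq[OF elim(3), of a] \<delta> by (simp add: a_def algebra_simps)
    then have "v - a * u m \<le> a ^ Suc N * \<eta> m / (a ^ N - 1)"
      using a by (simp add: pos_le_divide_eq mult.commute)
    then have 1: "v - a * u m < e / 2" using elim(1) by linarith
    have "(1 - b ^ N) * (b * u m - v) \<le> b ^ Suc N * \<eta> m"
      using ineq[OF elim(3), of b] \<delta> by (simp add: b_def algebra_simps)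
    then have "b * u m - v \<le> b ^ Suc N * \<eta> m / (1 - b ^ N)"
      using b by (simp add: pos_le_divide_eq mult.commute)
    then have 2: "b * u m - v < e / 2" using elim(2) by linarith
    have "a * u m = u m + \<delta> * u m" "b * u m = u m - \<delta> * u m"
      by (simp_all add: a_def b_def algebra_simps)
    then show ?case using 1 2 small by (simp add: abs_less_iff) linarith
  qed
  then show "\<exists>M. \<forall>m\<ge>M. norm (u m - v) < e" by (simp add: eventually_sequentially)
qed

text \<open>Scalar instances of the hypothesis say \<open>b = (K g)\<^bsup>1/N\<^esup>\<close>; inserting \<open>\<lambda> = c (K i/m)\<^bsup>1/N\<^esup>\<close> into the
  Bernstein sum and letting \<open>c\<close> tend to 1 from both sides identifies \<open>g b\<close> as a limit of
  polynomials in \<open>g\<close>.\<close>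

lemma root_form_tendsto:
  fixes b g :: "'a::{complex_inner, complete_space} bop"
  assumes g: "positive g" "positive (1 - g)" and comm: "b * g = g * b"
    and N: "N \<ge> 1" and K: "K > 0"
    and ineq: "\<And>r::real. r \<ge> 0 \<Longrightarrow> positive ((K *\<^sub>R g - r ^ N *\<^sub>R 1) * (b - r *\<^sub>R 1))"
  defines "p \<equiv> (\<lambda>m. bern_fun g m (\<lambda>i. root N (K * (real i / real m))))"
  shows "(\<lambda>m. Re (cinner (app (g * p m) x) x)) \<longlonglongrightarrow> Re (cinner (app (g * b) x) x)"
proof -
  define f where "f m i = root N (K * (real i / real m))" for m i :: nat
  define M where "M = root N K"
  define q where "q m = bern_fun g m (\<lambda>i. f m i * (real i / real m))" for m
  have p: "p m = bern_fun g m (f m)" for m unfolding p_def f_def ..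
  have pg: "p m * g = g * p m" for m unfolding p_def by (rule bern_fun_commute) simp
  have f0: "0 \<le> f m i" for m i unfolding f_def using K by (intro real_root_ge_zero) simp
  \<comment> \<open>For \<open>m = 0\<close> the quotient is 0 by convention, so the bound holds
    there too.\<close>
  have fM: "f m i \<le> M" if "i \<le> m" for m i
  proof -
    have "K * (real i / real m) \<le> K * 1"
      using K that by (intro mult_left_mono) (auto simp: divide_le_eq_1)
    then show ?thesis unfolding f_def M_def using N by (intro real_root_le_mono) auto
  qed
  have fN: "f m i ^ N = K * (real i / real m)" for m i
    unfolding f_def using K N by (intro real_root_pow_pos2) auto
  have main: "positive ((1 - c ^ N) *\<^sub>R (g * b - c *\<^sub>R (g * p m)) + c ^ Suc N *\<^sub>R (q m - g * p m))"
    if m: "m > 0" and c: "c \<ge> 0" for c m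
  proof -
    let ?x = "\<lambda>i. real i / real m"
    \<comment> \<open>Since \<open>f m i ^ N = K * ?x i\<close>, this is the hypothesis at
      \<open>r = c * f m i\<close>, divided by \<open>K\<close>.\<close>
    define F where "F i = (g - (c ^ N * ?x i) *\<^sub>R 1) * (b - (c * f m i) *\<^sub>R 1)" for i
    have F1: "F i = g * b - c *\<^sub>R (f m i *\<^sub>R g) - c ^ N *\<^sub>R (?x i *\<^sub>R b)
        + c ^ Suc N *\<^sub>R ((f m i * ?x i) *\<^sub>R 1)" for i
      by (simp add: F_def algebra_simps)
    have "positive (bern g m F)"
    proof (rule positive_bern[OF g])
      fix i
      have "positive ((1 / K) *\<^sub>R ((K *\<^sub>R g - (c * f m i) ^ N *\<^sub>R 1) * (b - (c * f m i) *\<^sub>R 1)))"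
        using K c f0[of m i] by (intro positive_scaleR ineq) auto
      also have "(1 / K) *\<^sub>R ((K *\<^sub>R g - (c * f m i) ^ N *\<^sub>R 1) * (b - (c * f m i) *\<^sub>R 1)) = F i"
        unfolding F_def mult_scaleR_left[symmetric] scaleR_right_diff_distrib
        using K by (simp add: power_mult_distrib fN)
      finally show "positive (F i)" .
      show "F i * g = g * F i"
        unfolding F_def by (rule commute_mult) (simp_all add: algebra_simps comm)
    qed
    also have "bern g m F = g * b - c *\<^sub>R (g * p m) - c ^ N *\<^sub>R (g * b) + c ^ Suc N *\<^sub>R q m"
      unfolding F1[abs_def] bern_add bern_diff bern_scaleR bern_const bern_fun_mult
      by (simp add: bern_fun_id[OF m] p q_def pg[unfolded p])
    also have "\<dots> = (1 - c ^ N) *\<^sub>R (g * b - c *\<^sub>R (g * p m)) + c ^ Suc N *\<^sub>R (q m - g * p m)"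
      by (simp add: algebra_simps)
    finally show ?thesis .
  qed
  define E where "E m = (M\<^sup>2 + 1) / sqrt (real m)" for m
  have near: "positive (2 *\<^sub>R (g * p m - q m) + E m *\<^sub>R 1)" if m: "m > 0" for m
  proof -
    define d where "d = sqrt (1 / sqrt (real m))"
    have d2: "d\<^sup>2 = 1 / sqrt (real m)" by (simp add: d_def)
    have "d > 0" using m by (simp add: d_def)
    have "positive (2 *\<^sub>R (g * p m - q m) + (d\<^sup>2 * M\<^sup>2 + 1 / (d\<^sup>2 * real m)) *\<^sub>R 1)"
      unfolding p q_def
      by (rule bern_fun_mult_id_approx[OF g m \<open>d > 0\<close>]) (use f0 fM in auto)
    also have "d\<^sup>2 * M\<^sup>2 + 1 / (d\<^sup>2 * real m) = E m"
      unfolding d2 E_def using m by (simp add: add_divide_distrib real_div_sqrt)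
    finally show ?thesis .
  qed
  have pos_gp: "positive (g * p m)" and le_gp: "positive (M *\<^sub>R 1 - g * p m)" for m
  proof -
    have fg: "bern g m (\<lambda>i. f m i *\<^sub>R g) = g * p m" by (simp add: bern_fun_mult p pg[unfolded p])
    show "positive (g * p m)"
      unfolding fg[symmetric] by (intro positive_bern g positive_scaleR f0) auto
    \<comment> \<open>At each node the difference is a combination of 1 and \<open>1 - g\<close>
      with nonnegative coefficients. It yields a bound on the forms of \<open>g * p m\<close> that
      is uniform in \<open>m\<close>.\<close>
    have "positive (bern g m (\<lambda>i. M *\<^sub>R 1 - f m i *\<^sub>R g))"
    proof (rule positive_bern[OF g])
      fix i assume "i \<le> m"
      then have "positive ((M - f m i) *\<^sub>R 1 + f m i *\<^sub>R (1 - g))"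
        using fM[of i m] f0[of m i] by (intro positive_add positive_scaleR g) auto
      then show "positive (M *\<^sub>R 1 - f m i *\<^sub>R g)" by (simp add: algebra_simps)
    qed (simp add: algebra_simps)
    then show "positive (M *\<^sub>R 1 - g * p m)" by (simp only: bern_diff bern_const fg)
  qed
  show ?thesis
  proof (rule tendsto_of_scaled_bounds[OF N])
    show "(\<lambda>m. (E m / 2) * (norm x)\<^sup>2) \<longlonglongrightarrow> 0"
      unfolding E_def by real_asymp
    show "\<bar>Re (cinner (app (g * p m) x) x)\<bar> \<le> M * (norm x)\<^sup>2" for m
      using positive_form[OF pos_gp[of m], of x] positive_form[OF le_gp[of m], of x]
      by (simp add: cinner_simps Re_cinner_self)
    fix c :: real and m :: nat assume m: "m > 0" and c: "c \<ge> 0"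
    \<comment> \<open>The multiple of \<open>near\<close> is chosen to cancel
      \<open>q m - g * p m\<close>, leaving only a scalar error.\<close>
    have "positive ((1 - c ^ N) *\<^sub>R (g * b - c *\<^sub>R (g * p m)) + c ^ Suc N *\<^sub>R (q m - g * p m)
        + (c ^ Suc N / 2) *\<^sub>R (2 *\<^sub>R (g * p m - q m) + E m *\<^sub>R 1))"
      using c by (intro positive_add positive_scaleR main near m) auto
    also have "(1 - c ^ N) *\<^sub>R (g * b - c *\<^sub>R (g * p m)) + c ^ Suc N *\<^sub>R (q m - g * p m)
        + (c ^ Suc N / 2) *\<^sub>R (2 *\<^sub>R (g * p m - q m) + E m *\<^sub>R 1)
        = (1 - c ^ N) *\<^sub>R (g * b - c *\<^sub>R (g * p m)) + (c ^ Suc N * (E m / 2)) *\<^sub>R 1"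
      by (simp add: algebra_simps)
    finally show "0 \<le> (1 - c ^ N) * (Re (cinner (app (g * b) x) x)
        - c * Re (cinner (app (g * p m) x) x)) + c ^ Suc N * ((E m / 2) * (norm x)\<^sup>2)"
      using positive_form[of _ x]
      by (fastforce simp: cinner_simps Re_cinner_self mult.assoc)
  qed
qed

lemma Re_cinner_polarization:
  assumes "star a = a"
  shows "2 * Re (cinner (app a x) y) = Re (cinner (app a (x + y)) (x + y))
    - Re (cinner (app a x) x) - Re (cinner (app a y) y)"
proof -
  have "Re (cinner (app a y) x) = Re (cinner (app a x) y)"
    using assms by (metis Re_cinner_commute cinner_star)
  then show ?thesis by (simp add: app_add_right cinner_simps)
qed

text \<open>The operators \<open>g * p m\<close> are polynomials in \<open>g\<close>, so they
  commute with \<open>t\<close>. Polarization upgrades convergence of their quadratic forms to weak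
  convergence to \<open>g * b\<close>, and weak limits respect commutation with \<open>t\<close>
  once \<open>t\<close> on the left is moved across as \<open>star t\<close>. What results is
  \<open>g * (b * t - t * b) = 0\<close>, where injectivity of \<open>g\<close> applies.\<close>

lemma root_commute:
  fixes b g t :: "'a::{complex_inner, complete_space} bop"
  assumes g: "positive g" "positive (1 - g)" and b: "star b = b" and comm: "b * g = g * b"
    and N: "N \<ge> 1" and K: "K > 0"
    and ineq: "\<And>r::real. r \<ge> 0 \<Longrightarrow> positive ((K *\<^sub>R g - r ^ N *\<^sub>R 1) * (b - r *\<^sub>R 1))"
    and gt: "g * t = t * g" and inj: "\<And>x. app g x = 0 \<Longrightarrow> x = 0"
  shows "b * t = t * b"
proof -
  define p where "p m = bern_fun g m (\<lambda>i. root N (K * (real i / real m)))" for m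
  have sg: "star g = g" by (rule positive_star[OF g(1)])
  have sa: "star (g * p m) = g * p m" for m
    unfolding p_def using bern_fun_commute[of g g m] by (simp add: sg star_bern_fun)
  have sb: "star (g * b) = g * b" using comm b sg by simp
  have lim: "(\<lambda>m. Re (cinner (app (g * p m) x) y)) \<longlonglongrightarrow> Re (cinner (app (g * b) x) y)" for x y
  proof -
    have "(\<lambda>m. 2 * Re (cinner (app (g * p m) x) y)) \<longlonglongrightarrow> 2 * Re (cinner (app (g * b) x) y)"
      unfolding Re_cinner_polarization[OF sa] Re_cinner_polarization[OF sb]
      by (intro tendsto_diff root_form_tendsto[OF g comm N K ineq, folded p_def])
    then show ?thesis by simp
  qed
  have gpt: "g * p m * t = t * (g * p m)" for m
    by (rule commute_mult[OF gt]) (simp add: p_def bern_fun_commute[OF gt])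
  have "Re (cinner (app (g * b * t) x) y) = Re (cinner (app (t * (g * b)) x) y)" for x y
  proof (rule LIMSEQ_unique)
    show "(\<lambda>m. Re (cinner (app (g * p m) (app t x)) y)) \<longlonglongrightarrow> Re (cinner (app (g * b * t) x) y)"
      unfolding app_times[of "g * b" t] by (rule lim)
    have "cinner (app (g * p m) (app t x)) y = cinner (app (g * p m) x) (app (star t) y)" for m
      unfolding app_times[of "g * p m" t, symmetric] gpt
      by (simp only: app_times[of t] cinner_star[of t])
    then show "(\<lambda>m. Re (cinner (app (g * p m) (app t x)) y)) \<longlonglongrightarrow> Re (cinner (app (t * (g * b)) x) y)"
      unfolding app_times[of t "g * b"] cinner_star[of t] by (simp only: lim)
  qed
  then have "Re (cinner (app (g * b * t - t * (g * b)) x) y) = 0" for x y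
    unfolding app_minus cinner_diff_left by simp
  then have "app (g * b * t - t * (g * b)) x = 0" for x
    by (metis Re_cinner_self norm_eq_zero power_eq_0_iff)
  then have "app g (app (b * t - t * b) x) = 0" for x
    using gt by (simp add: app_diff_right) (metis app_times)
  then have "app (b * t - t * b) x = app 0 x" for x
    using inj[of "app (b * t - t * b) x"] by simp
  then have "b * t - t * b = 0" by (rule bop_eqI)
  then show ?thesis by simp
qed

section \<open>Paranormal operators\<close>

text \<open>The arithmetic-geometric mean inequality turns the product of two norms into a sum of
  squares, so the paranormal inequality becomes a family of quadratic forms (Ando's
  criterion).\<close>

lemma positive_paranormal:
  fixes t :: "'a::{complex_inner, complete_space} bop"
  assumes "\<And>x. (norm (app t x))\<^sup>2 \<le> norm (app t (app t x)) * norm x"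
  shows "positive (star t ^ 2 * t ^ 2 - (2 * r) *\<^sub>R (star t * t) + r\<^sup>2 *\<^sub>R 1)"
  unfolding positive_def
proof (intro conjI allI)
  show "star (star t ^ 2 * t ^ 2 - (2 * r) *\<^sub>R (star t * t) + r\<^sup>2 *\<^sub>R 1)
      = star t ^ 2 * t ^ 2 - (2 * r) *\<^sub>R (star t * t) + r\<^sup>2 *\<^sub>R 1"
    by simp
  fix x
  let ?a = "norm (app t (app t x))" and ?b = "norm (app t x)" and ?c = "norm x"
  have "2 * r * ?b\<^sup>2 \<le> 2 * \<bar>r\<bar> * ?b\<^sup>2" by (intro mult_right_mono) auto
  also have "\<dots> \<le> 2 * \<bar>r\<bar> * (?a * ?c)" by (intro mult_left_mono assms) auto
  also have "\<dots> \<le> ?a\<^sup>2 + r\<^sup>2 * ?c\<^sup>2"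
    using sum_squares_bound[of ?a "\<bar>r\<bar> * ?c"] by (simp add: power_mult_distrib mult_ac)
  finally show "0 \<le> Re (cinner (app (star t ^ 2 * t ^ 2 - (2 * r) *\<^sub>R (star t * t) + r\<^sup>2 *\<^sub>R 1) x) x)"
    by (simp add: cinner_simps power2_eq_square[of "_ :: 'a bop"] Re_cinner_self
        cinner_star'[symmetric] cinner_star[of "star t"])
qed

text \<open>For numbers, with x^j in place of T*^j T^j, this is (x^j - r^j) (x - r), the sum over i
  < j of r^(j-1-i) x^i (x - r)^2. Accordingly, case \<open>Suc j\<close> is \<open>r\<close> times
  case \<open>j\<close> plus the conjugate by \<open>t ^ j\<close> of the quadratic expression;
  \<open>0 \<le> r\<close> keeps that combination positive. For \<open>j = 0\<close> the expression
  is 0.\<close>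

lemma positive_paranormal_power:
  fixes t :: "'a::{complex_inner, complete_space} bop"
  assumes para: "\<And>x. (norm (app t x))\<^sup>2 \<le> norm (app t (app t x)) * norm x" and r: "0 \<le> r"
  shows "positive (star t ^ Suc j * t ^ Suc j - r *\<^sub>R (star t ^ j * t ^ j)
    - r ^ j *\<^sub>R (star t * t) + r ^ Suc j *\<^sub>R 1)"
proof (induction j)
  case (Suc j)
  let ?B = "\<lambda>j. star t ^ j * t ^ j"
  have "positive (star (t ^ j) * (star t ^ 2 * t ^ 2 - (2 * r) *\<^sub>R (star t * t) + r\<^sup>2 *\<^sub>R 1) * t ^ j)"
    by (intro positive_conjugate positive_paranormal para)
  also have "star (t ^ j) * (star t ^ 2 * t ^ 2 - (2 * r) *\<^sub>R (star t * t) + r\<^sup>2 *\<^sub>R 1) * t ^ j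
      = ?B (Suc (Suc j)) - (2 * r) *\<^sub>R ?B (Suc j) + r\<^sup>2 *\<^sub>R ?B j"
  proof -
    have "star t ^ j * (star t ^ 2 * t ^ 2) * t ^ j = star t ^ (j + 2) * t ^ (2 + j)"
      "star t ^ j * (star t * t) * t ^ j = star t ^ (j + 1) * t ^ (1 + j)"
      unfolding power_add by (simp_all add: mult.assoc)
    moreover have "X * (A - c *\<^sub>R B + d *\<^sub>R 1) * Y = X * A * Y - c *\<^sub>R (X * B * Y) + d *\<^sub>R (X * Y)"
      for X A B Y :: "'a bop" and c d
      by (simp add: algebra_simps)
    ultimately show ?thesis by simp
  qed
  finally have "positive ((?B (Suc (Suc j)) - (2 * r) *\<^sub>R ?B (Suc j) + r\<^sup>2 *\<^sub>R ?B j)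
      + r *\<^sub>R (?B (Suc j) - r *\<^sub>R ?B j - r ^ j *\<^sub>R (star t * t) + r ^ Suc j *\<^sub>R 1))"
    by (rule positive_add[OF _ positive_scaleR[OF r Suc]])
  also have "(?B (Suc (Suc j)) - (2 * r) *\<^sub>R ?B (Suc j) + r\<^sup>2 *\<^sub>R ?B j)
      + r *\<^sub>R (?B (Suc j) - r *\<^sub>R ?B j - r ^ j *\<^sub>R (star t * t) + r ^ Suc j *\<^sub>R 1)
      = ?B (Suc (Suc j)) - r *\<^sub>R ?B (Suc j) - r ^ Suc j *\<^sub>R (star t * t) + r ^ Suc (Suc j) *\<^sub>R 1"
  proof -
    have "(X - (2 * r) *\<^sub>R Y + r\<^sup>2 *\<^sub>R Z) + r *\<^sub>R (Y - r *\<^sub>R Z - r ^ j *\<^sub>R W + r ^ Suc j *\<^sub>R V)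
        = X - r *\<^sub>R Y - r ^ Suc j *\<^sub>R W + r ^ Suc (Suc j) *\<^sub>R V" for X Y Z W V :: "'a bop"
      by (simp add: algebra_simps power2_eq_square flip: scaleR_add_left)
    then show ?thesis .
  qed
  finally show ?case .
qed simp

text \<open>With \<open>h = t*\<^sup>N t\<^sup>N\<close> and \<open>b = t* t\<close>, Fuglede's theorem makes \<open>h\<close> commute with \<open>t\<close>, so
  \<open>positive_paranormal_power\<close> for \<open>j = N\<close> factors as \<open>(h - r\<^sup>N) (b - r) \<ge> 0\<close>.\<close>

theorem paranormal_power_normal:
  fixes t :: "'a::{complex_inner, complete_space} bop"
  assumes para: "\<And>x. (norm (app t x))\<^sup>2 \<le> norm (app t (app t x)) * norm x" and N: "N \<ge> 1"
    and normal: "t ^ N * star (t ^ N) = star (t ^ N) * t ^ N"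
    and inj: "\<And>x. app (t ^ N) x = 0 \<Longrightarrow> x = 0"
  shows "star t * t * t = t * (star t * t)"
proof -
  define h where "h = star (t ^ N) * t ^ N"
  have tn: "t * t ^ N = t ^ N * t" by (simp add: power_commutes)
  have ht: "h * t = t * h"
    unfolding h_def by (rule commute_mult[OF fuglede[OF normal tn, symmetric] tn[symmetric]])
  have sh: "star h = h" by (simp add: h_def)
  have hs: "h * star t = star t * h" using arg_cong[OF ht, of star] sh by simp
  have hb: "(star t * t) * h = h * (star t * t)" by (intro commute_mult hs[symmetric] ht[symmetric])
  obtain K' where K': "op_bound K' h" using op_bound_exists by blast
  \<comment> \<open>The added 1 makes \<open>K\<close> strictly positive even if
    \<open>h = 0\<close>, so that \<open>h\<close> can be scaled into the range between 0 and
    1.\<close>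
  define K where "K = K' + 1"
  have K: "K > 0" using op_bound_nonneg[OF K'] by (simp add: K_def)
  define g where "g = (1 / K) *\<^sub>R h"
  have Kg: "K *\<^sub>R g = h" using K by (simp add: g_def)
  show ?thesis
  proof (rule root_commute[where g = g and N = N and K = K])
    show "positive g"
      unfolding g_def h_def using K by (intro positive_scaleR positive_star_mult) simp
    show "positive (1 - g)"
      unfolding positive_def
    proof (intro conjI allI)
      show "star (1 - g) = 1 - g" by (simp add: g_def sh)
      fix x
      have "Re (cinner (app h x) x) \<le> K' * norm x * norm x"
        using Re_cinner_le[of "app h x" x] mult_right_mono[OF op_boundD[OF K', of x] norm_ge_zero[of x]]
        by linarith
      also have "\<dots> \<le> K * (norm x)\<^sup>2"
        by (simp add: K_def power2_eq_square distrib_right mult.assoc)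
      finally show "0 \<le> Re (cinner (app (1 - g) x) x)"
        using K by (simp add: g_def cinner_simps Re_cinner_self field_simps)
    qed
    show "star (star t * t) = star t * t" by simp
    show "star t * t * g = g * (star t * t)" using hb by (simp add: g_def mult.assoc)
    show "g * t = t * g" using ht by (simp add: g_def)
    show "x = 0" if "app g x = 0" for x
    proof (rule inj)
      have "app h x = 0" using that K by (simp add: g_def)
      then have "cinner (app (t ^ N) x) (app (t ^ N) x) = 0"
        by (simp add: h_def cinner_star' del: star_power)
      then show "app (t ^ N) x = 0" by (simp add: cinner_self_eq_zero)
    qed
    show "positive ((K *\<^sub>R g - r ^ N *\<^sub>R 1) * (star t * t - r *\<^sub>R 1))" if r: "r \<ge> 0" for r
    proof -
      have "star t ^ Suc N * t ^ Suc N = star t * h * t"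
        by (simp add: h_def mult.assoc power_commutes)
      also have "\<dots> = h * (star t * t)" by (simp add: hs[symmetric] mult.assoc)
      finally have "star t ^ Suc N * t ^ Suc N - r *\<^sub>R (star t ^ N * t ^ N)
          - r ^ N *\<^sub>R (star t * t) + r ^ Suc N *\<^sub>R 1
          = (K *\<^sub>R g - r ^ N *\<^sub>R 1) * (star t * t - r *\<^sub>R 1)"
        unfolding Kg by (simp add: h_def[symmetric, simplified] algebra_simps)
      then show ?thesis using positive_paranormal_power[OF para r, of N] by simp
    qed
  qed (use N K in auto)
qed

section \<open>Operators with dense range\<close>

lemma closure_range_funpow:
  fixes f :: "'a::topological_space \<Rightarrow> 'a"
  assumes "continuous_on UNIV f" and "closure (range f) = UNIV"
  shows "closure (range (f ^^ k)) = UNIV"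
proof (induction k)
  case (Suc k)
  have "range f = f ` closure (range (f ^^ k))" by (simp add: Suc)
  also have "\<dots> \<subseteq> closure (f ` range (f ^^ k))"
    by (rule image_closure_subset[OF continuous_on_subset[OF assms(1)] closed_closure closure_subset])
      simp
  also have "f ` range (f ^^ k) = range (f ^^ Suc k)" by (simp add: image_comp)
  finally have "closure (range f) \<subseteq> closure (range (f ^^ Suc k))"
    by (rule closure_minimal) simp
  then show ?case by (metis assms(2) top.extremum_uniqueI)
qed simp

lemma continuous_app: "continuous_on A (app a)"
  by (simp add: linear_continuous_on)

lemma dense_imp_all:
  assumes "closure A = UNIV" and "closed {x. P x}" and "\<And>x. x \<in> A \<Longrightarrow> P x"
  shows "\<forall>x. P x"
  using closure_minimal[of A "{x. P x}"] assms by auto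

text \<open>Cancels a right factor with dense range; this is how quasinormality becomes
  normality.\<close>

lemma bop_eqI_dense:
  assumes "closure (range (app t)) = UNIV" and "a * t = b * t"
  shows "a = b"
proof -
  have "\<forall>x. app a x = app b x"
  proof (rule dense_imp_all[OF assms(1)])
    show "closed {x. app a x = app b x}"
      by (intro closed_Collect_eq continuous_app)
    show "app a x = app b x" if "x \<in> range (app t)" for x
      using that assms(2) by (metis app_times imageE)
  qed
  then show ?thesis by (intro bop_eqI) blast
qed

section \<open>Normal and quasinormal operators in terms of the ring\<close>

lemma quasinormal_app: "quasinormal (app a) \<longleftrightarrow> star a * a * a = a * star a * a"
proof -
  have "quasinormal (app a) \<longleftrightarrow> (\<forall>x. app (star a * a * a) x = app (a * star a * a) x)"
    by (simp add: quasinormal_def app_star[symmetric])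
  then show ?thesis using bop_eqI by metis
qed

lemma normal_op_app: "normal_op (app a) \<longleftrightarrow> star a * a = a * star a"
proof -
  have "normal_op (app a) \<longleftrightarrow> (\<forall>x. app (star a * a) x = app (a * star a) x)"
    by (simp add: normal_op_def app_star[symmetric] fun_eq_iff)
  then show ?thesis using bop_eqI by metis
qed

lemma normal_power:
  assumes "star a * a = a * star a"
  shows "star (a ^ n) * a ^ n = a ^ n * star (a ^ n)"
proof -
  have "a ^ n * star a = star a * a ^ n" by (rule power_commuting) (simp add: assms)
  then show ?thesis using power_commuting[of "star a" "a ^ n" n] by simp
qed

lemma normal_power_quasinormal:
  "star a * a = a * star a \<Longrightarrow> quasinormal (app (a ^ n))"
  using normal_power[of a n] by (simp add: quasinormal_app)

lemma normal_inverse: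
  assumes "star t * t = t * star t" and ut: "u * t = 1" and tu: "t * u = 1"
  shows "star u * u = u * star u"
proof -
  have su: "star u * star t = 1" "star t * star u = 1"
    using arg_cong[OF tu, of star] arg_cong[OF ut, of star] by simp_all
  \<comment> \<open>The identity is inserted as \<open>star t * t * u * star u\<close>, so that
    normality of \<open>t\<close> can be applied between inverse pairs.\<close>
  have "star u * u = star u * u * ((star t * (t * u)) * star u)" by (simp add: tu su)
  also have "\<dots> = star u * (u * (star t * t)) * (u * star u)" by (simp only: mult.assoc)
  also have "u * (star t * t) = u * t * star t" by (simp only: assms(1) mult.assoc)
  finally show ?thesis by (simp add: ut su)
qed

text \<open>A normal operator and its adjoint have the same kernel, and the kernel of the adjoint is
  the orthogonal complement of the range.\<close>

lemma normal_dense_range_injective: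
  assumes normal: "star a * a = a * star a" and dense: "closure (range (app a)) = UNIV"
    and x: "app a x = 0"
  shows "x = 0"
proof -
  have "cinner (app (star a) x) (app (star a) x) = cinner (app (a * star a) x) x"
    by (simp add: cinner_star')
  also have "\<dots> = 0" unfolding normal[symmetric] by (simp add: x)
  finally have "app (star a) x = 0" by (simp add: cinner_self_eq_zero)
  then have "cinner y x = 0" if "y \<in> range (app a)" for y
    using that by (auto simp: cinner_star)
  moreover have "closed {y. cinner y x = 0}"
    by (intro closed_Collect_eq continuous_on_const)
      (auto simp: continuous_on_def intro!: tendsto_cinner_left)
  ultimately have "\<forall>y. cinner y x = 0" by (intro dense_imp_all[OF dense])
  then have "cinner x x = 0" by blast
  then show ?thesis by (simp add: cinner_self_eq_zero)
qed

text \<open>Density acts three times: it makes \<open>t ^ n\<close> normal, it makes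
  \<open>t ^ n\<close> injective, and it cancels the last factor \<open>t\<close>.\<close>

lemma paranormal_dense_power_quasinormal:
  assumes para: "paranormal (app t)" and dense: "closure (range (app t)) = UNIV"
    and n: "n \<ge> 1" and qn: "quasinormal (app (t ^ n))"
  shows "star t * t = t * star t"
proof -
  have dense_n: "closure (range (app (t ^ n))) = UNIV"
    unfolding app_power by (rule closure_range_funpow[OF continuous_app dense])
  have normal: "star (t ^ n) * t ^ n = t ^ n * star (t ^ n)"
    by (rule bop_eqI_dense[OF dense_n qn[unfolded quasinormal_app]])
  have "star t * t * t = t * (star t * t)"
  proof (rule paranormal_power_normal[OF _ n normal[symmetric]])
    show "(norm (app t x))\<^sup>2 \<le> norm (app t (app t x)) * norm x" for x
      using para by (simp add: paranormal_def numeral_2_eq_2)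
    show "x = 0" if "app (t ^ n) x = 0" for x
      by (rule normal_dense_range_injective[OF normal dense_n that])
  qed
  also have "t * (star t * t) = t * star t * t" by (simp only: mult.assoc)
  finally show ?thesis by (rule bop_eqI_dense[OF dense])
qed

text \<open>The hypothesis is the paranormal inequality on the range of \<open>T ^^ k\<close>; that
  range is dense and both sides are continuous.\<close>

lemma k_quasiparanormal_dense:
  assumes T: "bounded_op T" and dense: "closure (range T) = UNIV" and qp: "k_quasiparanormal k T"
  shows "paranormal T"
  unfolding paranormal_def
proof -
  have cont: "continuous_on A T" for A
    using T by (simp add: bounded_op_linear linear_continuous_on)
  have cont2: "continuous_on A (T ^^ 2)" for A
    using continuous_on_compose[OF cont cont, of A] by (simp add: numeral_2_eq_2)
  show "\<forall>x. (norm (T x))\<^sup>2 \<le> norm ((T ^^ 2) x) * norm x"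
  proof (rule dense_imp_all[OF closure_range_funpow[OF cont dense, of k]])
    show "closed {x. (norm (T x))\<^sup>2 \<le> norm ((T ^^ 2) x) * norm x}"
      by (intro closed_Collect_le continuous_intros cont cont2)
    show "(norm (T x))\<^sup>2 \<le> norm ((T ^^ 2) x) * norm x" if "x \<in> range (T ^^ k)" for x
      using that qp by (auto simp: k_quasiparanormal_def)
  qed
qed

lemma paranormal_k_quasiparanormal: "paranormal T \<Longrightarrow> k_quasiparanormal j T"
  by (simp add: paranormal_def k_quasiparanormal_def)

text \<open>At the vector \<open>S (S x)\<close> the inequality for \<open>T\<close> has
  \<open>norm x\<close> and \<open>norm (S (S x))\<close> trading places, which leaves their product
  unchanged.\<close>

lemma paranormal_inverse:
  assumes "paranormal T" and "\<And>x. T (S x) = x"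
  shows "paranormal S"
  unfolding paranormal_def
proof
  fix x
  show "(norm (S x))\<^sup>2 \<le> norm ((S ^^ 2) x) * norm x"
    using assms(1)[unfolded paranormal_def, rule_format, of "S (S x)"]
    by (simp add: numeral_2_eq_2 assms(2) mult.commute)
qed

theorem theorem6p7:
  fixes T :: "'a::{complex_inner, complete_space} \<Rightarrow> 'a" and k :: nat
  assumes "bounded_op T" and "k \<ge> 1" and "k_quasiparanormal k T"
  shows "(invertible_op T \<longrightarrow>
            (paranormal T \<and> paranormal (inv T) \<and>
             (\<forall>j\<ge>1. k_quasiparanormal j T \<and> k_quasiparanormal j (inv T))) \<and>
            (\<forall>n\<ge>1. (quasinormal (T ^^ n) \<or> quasinormal (inv T ^^ n)) \<longrightarrow>
                 quasinormal (T ^^ n) \<and> quasinormal (inv T ^^ n) \<and>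
                 normal_op T \<and> normal_op (inv T)))
       \<and> (closure (range T) = UNIV \<longrightarrow>
            (\<forall>n\<ge>1. quasinormal (T ^^ n) \<longrightarrow> normal_op T))"
proof (intro conjI impI)
  define t where "t = Bop T"
  have t: "T = app t" using assms(1) by (simp add: t_def Bop_inverse)
  have para: "paranormal T" if "closure (range T) = UNIV"
    by (rule k_quasiparanormal_dense[OF assms(1) that assms(3)])
  show "\<forall>n\<ge>1. quasinormal (T ^^ n) \<longrightarrow> normal_op T" if "closure (range T) = UNIV"
    using paranormal_dense_power_quasinormal[of t] para[OF that] that
    by (auto simp: t app_power normal_op_app)
  assume "invertible_op T"
  then obtain S where S: "bounded_op S" "S \<circ> T = id" "T \<circ> S = id"
    by (auto simp: invertible_op_def)
  have inv: "inv T = S" using S by (intro inv_unique_comp)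
  define u where "u = Bop S"
  have u: "S = app u" using S(1) by (simp add: u_def Bop_inverse)
  have TS: "T (S x) = x" and ST: "S (T x) = x" for x using S by (auto simp: fun_eq_iff)
  have ut: "u * t = 1" "t * u = 1"
    by (rule bop_eqI; simp add: t[symmetric] u[symmetric] TS ST)+
  have dense: "closure (range T) = UNIV" "closure (range S) = UNIV"
    using surjI[of T S, OF TS] surjI[of S T, OF ST] by simp_all
  note para_T = para[OF dense(1)]
  have para_S: "paranormal S" by (rule paranormal_inverse[OF para_T TS])
  show "paranormal T" "paranormal (inv T)"
    "\<forall>j\<ge>1. k_quasiparanormal j T \<and> k_quasiparanormal j (inv T)"
    using para_T para_S by (simp_all add: inv paranormal_k_quasiparanormal)
  show "\<forall>n\<ge>1. (quasinormal (T ^^ n) \<or> quasinormal (inv T ^^ n)) \<longrightarrow>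
      quasinormal (T ^^ n) \<and> quasinormal (inv T ^^ n) \<and> normal_op T \<and> normal_op (inv T)"
  proof (intro allI impI)
    fix n :: nat
    assume n: "n \<ge> 1" and "quasinormal (T ^^ n) \<or> quasinormal (inv T ^^ n)"
    then consider "quasinormal (app (t ^ n))" | "quasinormal (app (u ^ n))"
      unfolding inv unfolding t u app_power by blast
    then have normal: "star t * t = t * star t \<and> star u * u = u * star u"
    proof cases
      case 1
      then have "star t * t = t * star t"
        using paranormal_dense_power_quasinormal[OF _ _ n] para_T dense(1) by (simp add: t)
      then show ?thesis using normal_inverse[OF _ ut] by simp
    \<comment> \<open>The inverse is itself paranormal with dense range, so the same argument runs
      with the roles of \<open>t\<close> and \<open>u\<close> exchanged.\<close>
    next
      case 2
      then have "star u * u = u * star u"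
        using paranormal_dense_power_quasinormal[OF _ _ n] para_S dense(2) by (simp add: u)
      then show ?thesis using normal_inverse[OF _ ut(2,1)] by simp
    qed
    then show "quasinormal (T ^^ n) \<and> quasinormal (inv T ^^ n) \<and> normal_op T \<and> normal_op (inv T)"
      using normal_power_quasinormal[of t n] normal_power_quasinormal[of u n]
      unfolding inv unfolding t u app_power normal_op_app by blast
  qed
qed

end
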